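(* There is an algorithm, with running time bounded by a polynomial of degree $8$, which decides for any essentially finite $\Gamma\subseteq BN(C)$ that is not plainly contradictory whether $\Gamma$ is contradictory, and which assigns a Leibniz model of $\Gamma$ to $\Gamma$ if it is not contradictory.
   Context: Fix a set $C$ of constants with at least three elements. $BN(C)$ is the set of all strings (basic sentences) $Yab$ with $Y\in\{A,E,I,O\}$, $a,b\in C$ ($a=b$ allowed). Contradictories: $\widehat{Aab}=Oab$, $\widehat{Oab}=Aab$, $\widehat{Eab}=Iab$, $\widehat{Iab}=Eab$. The $d$-rules (for all $a,b,c\in C$): (A-Id) infer $Aaa$ from no premises; (Apc) from $Aab$ infer $Iba$; (Ec) from $Eab$ infer $Eba$; (Barbara) from $Aab,Abc$ infer $Aac$; (Celarent) from $Aab,Ebc$ infer $Eac$. For $\Gamma\subseteq BN(C)$, $\Gamma\vdash^{d}\sigma$ means that there is a finite nonempty sequence of basic sentences ending in $\sigma$, each of whose terms is in $\Gamma$ or is the conclusion of a $d$-rule instance whose premises are earlier terms. $\Gamma$ is contradictory (inconsistent) if $\Gamma\vdash^{d}\sigma$ and $\Gamma\vdash^{d}\widehat\sigma$ for some $\sigma\in BN(C)$. $C_\Gamma$ is the set of $c\in C$ that occur in some element of $\Gamma$ having two distinct constants; $\Gamma$ is essentially finite if $C_\Gamma$ is finite. $BN(C_\Gamma)$ is the set of basic sentences whose constants are both in $C_\Gamma$. $\Gamma$ is plainly contradictory if $Ecc\in\Gamma$ or $Occ\in\Gamma$ for some $c\in C$. Leibniz models: let $\mathbb{N}$ be the natural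 numbers including $0$, and $m\,\eta\,n$ mean that $m$ is a multiple of $n$ (so $0\,\eta\,n$ for all $n$). Let $B=\{(m,n)\in\mathbb{N}\times\mathbb{N}:\gcd(m,n)=1\}$ (with $\gcd(0,n)=n$), and let $(m_1,n_1)R(m_2,n_2)$ iff $m_1\,\eta\,m_2$ and $n_1\,\eta\,n_2$. A Leibniz model is given by a map $\mu:C\to B$; in it $Aab$ is true iff $\mu(a)R\mu(b)$; $Iab$ is true iff there is $x\in B$ with $xR\mu(a)$ and $xR\mu(b)$; $Eab$ is true iff $Iab$ is not; $Oab$ is true iff $Aab$ is not. It is a model of $\Gamma$ if all elements of $\Gamma$ are true in it. Conventions for the algorithm: the input is the finite set $\Gamma'=\Gamma\cap BN(C_\Gamma)$ presented as a list of triples (symbol, constant, constant), possibly with $C_\Gamma$ as a secondary input; the running time is the number of simple steps (comparisons and assignments) and is measured as a function of $n=|\Gamma'|$. A Leibniz model is output by giving the values $\mu(c)$ for $c\in C_\Gamma$, all constants outside $C_\Gamma$ being assigned one fixed element of $B$. *)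

theory Defs
  imports "HOL-Computational_Algebra.Polynomial"
begin

section \<open>Basic sentences and the deductive system\<close>

datatype symb = YA | YE | YI | YO

type_synonym 'c sentence = "symb \<times> 'c \<times> 'c"

definition BN :: "'c set \<Rightarrow> 'c sentence set" where
  "BN C = UNIV \<times> C \<times> C"

fun contradictory_of :: "'c sentence \<Rightarrow> 'c sentence" where
  "contradictory_of (YA, a, b) = (YO, a, b)"
| "contradictory_of (YO, a, b) = (YA, a, b)"
| "contradictory_of (YE, a, b) = (YI, a, b)"
| "contradictory_of (YI, a, b) = (YE, a, b)"

text \<open>\<open>d_rule C P \<sigma>\<close>: the set \<open>P\<close> consists of the premises, and \<open>\<sigma>\<close> is the conclusion,
  of an instance of a d-rule with constants in \<open>C\<close>.\<close>

inductive d_rule :: "'c set \<Rightarrow> 'c sentence set \<Rightarrow> 'c sentence \<Rightarrow> bool" for C where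
  A_Id: "a \<in> C \<Longrightarrow> d_rule C {} (YA, a, a)"
| Apc: "a \<in> C \<Longrightarrow> b \<in> C \<Longrightarrow> d_rule C {(YA, a, b)} (YI, b, a)"
| Ec: "a \<in> C \<Longrightarrow> b \<in> C \<Longrightarrow> d_rule C {(YE, a, b)} (YE, b, a)"
| Barbara: "a \<in> C \<Longrightarrow> b \<in> C \<Longrightarrow> c \<in> C \<Longrightarrow> d_rule C {(YA, a, b), (YA, b, c)} (YA, a, c)"
| Celarent: "a \<in> C \<Longrightarrow> b \<in> C \<Longrightarrow> c \<in> C \<Longrightarrow> d_rule C {(YA, a, b), (YE, b, c)} (YE, a, c)"

definition derivation :: "'c set \<Rightarrow> 'c sentence set \<Rightarrow> 'c sentence list \<Rightarrow> bool" where
  "derivation C \<Gamma> ss \<longleftrightarrow> ss \<noteq> [] \<and> set ss \<subseteq> BN C \<and>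
     (\<forall>i<length ss. ss ! i \<in> \<Gamma> \<or> (\<exists>P. d_rule C P (ss ! i) \<and> P \<subseteq> set (take i ss)))"

definition derives :: "'c set \<Rightarrow> 'c sentence set \<Rightarrow> 'c sentence \<Rightarrow> bool" where
  "derives C \<Gamma> \<sigma> \<longleftrightarrow> (\<exists>ss. derivation C \<Gamma> ss \<and> last ss = \<sigma>)"

definition contradictory :: "'c set \<Rightarrow> 'c sentence set \<Rightarrow> bool" where
  "contradictory C \<Gamma> \<longleftrightarrow> (\<exists>\<sigma>\<in>BN C. derives C \<Gamma> \<sigma> \<and> derives C \<Gamma> (contradictory_of \<sigma>))"

text \<open>The set written $C_\Gamma$; for \<open>\<Gamma> \<subseteq> BN C\<close> it is contained in \<open>C\<close>.\<close>

definition linked_consts :: "'c sentence set \<Rightarrow> 'c set" where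
  "linked_consts \<Gamma> = {c. \<exists>Y a b. (Y, a, b) \<in> \<Gamma> \<and> a \<noteq> b \<and> (c = a \<or> c = b)}"

definition essentially_finite :: "'c sentence set \<Rightarrow> bool" where
  "essentially_finite \<Gamma> \<longleftrightarrow> finite (linked_consts \<Gamma>)"

definition plainly_contradictory :: "'c set \<Rightarrow> 'c sentence set \<Rightarrow> bool" where
  "plainly_contradictory C \<Gamma> \<longleftrightarrow> (\<exists>c\<in>C. (YE, c, c) \<in> \<Gamma> \<or> (YO, c, c) \<in> \<Gamma>)"


section \<open>Leibniz models\<close>

definition leibniz_base :: "(nat \<times> nat) set" where
  "leibniz_base = {(m, n). gcd m n = 1}"

text \<open>``\<open>m\<close> is a multiple of \<open>n\<close>'' is \<open>n dvd m\<close>.\<close>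

definition leibniz_rel :: "nat \<times> nat \<Rightarrow> nat \<times> nat \<Rightarrow> bool" where
  "leibniz_rel u v \<longleftrightarrow> fst v dvd fst u \<and> snd v dvd snd u"

fun leibniz_true :: "('c \<Rightarrow> nat \<times> nat) \<Rightarrow> 'c sentence \<Rightarrow> bool" where
  "leibniz_true \<mu> (YA, a, b) \<longleftrightarrow> leibniz_rel (\<mu> a) (\<mu> b)"
| "leibniz_true \<mu> (YI, a, b) \<longleftrightarrow> (\<exists>x\<in>leibniz_base. leibniz_rel x (\<mu> a) \<and> leibniz_rel x (\<mu> b))"
| "leibniz_true \<mu> (YE, a, b) \<longleftrightarrow> \<not> (\<exists>x\<in>leibniz_base. leibniz_rel x (\<mu> a) \<and> leibniz_rel x (\<mu> b))"
| "leibniz_true \<mu> (YO, a, b) \<longleftrightarrow> \<not> leibniz_rel (\<mu> a) (\<mu> b)"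

definition leibniz_model :: "'c set \<Rightarrow> ('c \<Rightarrow> nat \<times> nat) \<Rightarrow> 'c sentence set \<Rightarrow> bool" where
  "leibniz_model C \<mu> \<Gamma> \<longleftrightarrow> \<mu> ` C \<subseteq> leibniz_base \<and> (\<forall>\<sigma>\<in>\<Gamma>. leibniz_true \<mu> \<sigma>)"


section \<open>Algorithms and their running time\<close>

text \<open>
  Algorithms are programs of a small imperative language with one-dimensional arrays.  A memory cell
  holds a natural number, one of the four symbols, or a constant.  Constants are opaque: programs
  contain no literals for them, and can only copy them and test them for equality.

  The running time is the number of executed assignments and comparisons.  The only arithmetic
  operation is addition, so that the numbers produced in \<open>t\<close> steps have \<open>O(t)\<close> more bits than those
  in the input and in the program text; in particular unit-cost multiplication is not available.
  Expressions are part of the program text, so evaluating one takes a number of elementary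
  operations that does not depend on the input.
\<close>

datatype 'c val = Num nat | Sym symb | Con 'c

type_synonym 'c state = "string \<Rightarrow> nat \<Rightarrow> 'c val"

fun num :: "'c val \<Rightarrow> nat" where
  "num (Num n) = n"
| "num _ = 0"

text \<open>\<open>Cell x e\<close> is the cell of array \<open>x\<close> at index \<open>e\<close>; a scalar variable is cell \<open>0\<close> of an array.\<close>

datatype aexp = NumLit nat | SymLit symb | Cell string aexp | Plus aexp aexp

datatype cond = Eq aexp aexp | Less aexp aexp

datatype com =
    SKIP
  | Assign string aexp aexp
  | Seq com com
  | IF cond com com
  | WHILE cond com

fun aval :: "aexp \<Rightarrow> 'c state \<Rightarrow> 'c val" where
  "aval (NumLit n) s = Num n"
| "aval (SymLit Y) s = Sym Y"
| "aval (Cell x e) s = s x (num (aval e s))"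
| "aval (Plus e1 e2) s = Num (num (aval e1 s) + num (aval e2 s))"

fun holds :: "cond \<Rightarrow> 'c state \<Rightarrow> bool" where
  "holds (Eq e1 e2) s \<longleftrightarrow> aval e1 s = aval e2 s"
| "holds (Less e1 e2) s \<longleftrightarrow> num (aval e1 s) < num (aval e2 s)"

text \<open>\<open>exec c s t s'\<close>: started in \<open>s\<close>, the program \<open>c\<close> halts in \<open>s'\<close> after exactly \<open>t\<close> steps.\<close>

inductive exec :: "com \<Rightarrow> 'c state \<Rightarrow> nat \<Rightarrow> 'c state \<Rightarrow> bool" where
  Skip: "exec SKIP s 0 s"
| Assign: "exec (Assign x i e) s 1 (s(x := (s x)(num (aval i s) := aval e s)))"
| Seq: "exec c1 s t1 s' \<Longrightarrow> exec c2 s' t2 s'' \<Longrightarrow> exec (Seq c1 c2) s (t1 + t2) s''"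
| IfTrue: "holds b s \<Longrightarrow> exec c1 s t s' \<Longrightarrow> exec (IF b c1 c2) s (1 + t) s'"
| IfFalse: "\<not> holds b s \<Longrightarrow> exec c2 s t s' \<Longrightarrow> exec (IF b c1 c2) s (1 + t) s'"
| WhileFalse: "\<not> holds b s \<Longrightarrow> exec (WHILE b c) s 1 s"
| WhileTrue: "holds b s \<Longrightarrow> exec c s t1 s' \<Longrightarrow> exec (WHILE b c) s' t2 s''
    \<Longrightarrow> exec (WHILE b c) s (1 + t1 + t2) s''"

text \<open>Execution is deterministic, so the existence of a terminating execution with given
  properties expresses total correctness.\<close>

lemma exec_deterministic:
  "exec c s t s' \<Longrightarrow> exec c s u s'' \<Longrightarrow> u = t \<and> s'' = s'"
proof (induction arbitrary: u s'' rule: exec.induct)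
  case (Skip s)
  then show ?case by (cases rule: exec.cases) auto
next
  case (Assign x i e s)
  then show ?case by (cases rule: exec.cases) auto
next
  case (Seq c1 s t1 s1 c2 t2 s2)
  from Seq.prems obtain u1 u2 r where
    "exec c1 s u1 r" "exec c2 r u2 s''" "u = u1 + u2"
    by (cases rule: exec.cases) auto
  with Seq.IH show ?case by blast
next
  case (IfTrue b s c1 t s1 c2)
  from IfTrue.prems IfTrue.hyps(1) obtain v where "exec c1 s v s''" "u = 1 + v"
    by (cases rule: exec.cases) auto
  with IfTrue.IH show ?case by blast
next
  case (IfFalse b s c2 t s1 c1)
  from IfFalse.prems IfFalse.hyps(1) obtain v where "exec c2 s v s''" "u = 1 + v"
    by (cases rule: exec.cases) auto
  with IfFalse.IH show ?case by blast
next
  case (WhileFalse b s c)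
  from WhileFalse.prems WhileFalse.hyps show ?case by (cases rule: exec.cases) auto
next
  case (WhileTrue b s c t1 s1 t2 s2)
  from WhileTrue.prems WhileTrue.hyps(1) obtain u1 u2 r where
    "exec c s u1 r" "exec (WHILE b c) r u2 s''" "u = 1 + u1 + u2"
    by (cases rule: exec.cases) auto
  with WhileTrue.IH show ?case by blast
qed

text \<open>The input list is stored in three arrays, its length in the scalar \<open>''n''\<close>; all other cells
  hold \<open>0\<close>.\<close>

definition input_state :: "'c sentence list \<Rightarrow> 'c state" where
  "input_state xs = (\<lambda>x i.
     if x = ''n'' \<and> i = 0 then Num (length xs)
     else if x = ''symbol'' \<and> i < length xs then Sym (fst (xs ! i))
     else if x = ''first'' \<and> i < length xs then Con (fst (snd (xs ! i)))
     else if x = ''second'' \<and> i < length xs then Con (snd (snd (xs ! i)))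
     else Num 0)"

text \<open>The output consists of a verdict and of a table whose rows are a constant \<open>c\<close> and the two
  components of \<open>\<mu> c\<close>.\<close>

definition verdict :: "'c state \<Rightarrow> 'c val" where
  "verdict s = s ''contradictory'' 0"

definition output_table :: "'c state \<Rightarrow> ('c val \<times> 'c val \<times> 'c val) list" where
  "output_table s = map (\<lambda>i. (s ''constant'' i, s ''left'' i, s ''right'' i))
     [0..<num (s ''rows'' 0)]"

definition outputs_values :: "'c state \<Rightarrow> 'c set \<Rightarrow> ('c \<Rightarrow> nat \<times> nat) \<Rightarrow> bool" where
  "outputs_values s D \<mu> \<longleftrightarrow>
     set (output_table s) = (\<lambda>c. (Con c, Num (fst (\<mu> c)), Num (snd (\<mu> c)))) ` D"

end

theory Submission
  imports Defs
begin

text \<open>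
  Write \<open>a \<le> b\<close> if \<open>b\<close> is reachable from \<open>a\<close> along the sentences \<open>Acd\<close> of the input
  \<open>xs\<close>.  If some \<open>Ecd\<close> in \<open>xs\<close> has both \<open>c\<close> and \<open>d\<close> above a single constant, or above
  one of \<open>a\<close>, \<open>b\<close> for some \<open>Iab\<close> in \<open>xs\<close>, or if \<open>a \<le> b\<close> for some \<open>Oab\<close> in \<open>xs\<close>, then a
  contradiction is derivable.  Otherwise attach to the \<open>i\<close>-th sentence \<open>Y c d\<close> a number
  \<open>g i > 1\<close>, pairwise coprime, and let \<open>g i\<close> divide the left component of \<open>\<mu> a\<close> iff
  \<open>Y = E\<close> and \<open>a \<le> c\<close>, and the right component iff \<open>a \<le> d\<close>.  This is a model, and the
  calculus is sound for Leibniz models.  With \<open>g i = 1 + (i + 1) * n!\<close> (as in Goedel's beta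
  function) products of the \<open>g i\<close> are computable with few additions, without searching for primes.
  Reachability and all products take \<open>O(n^4)\<close> steps, well within degree 8.
\<close>

section \<open>Derivations and their soundness\<close>

lemma derivation_append:
  assumes "derivation C \<Gamma> ss" "derivation C \<Gamma> ts"
  shows "derivation C \<Gamma> (ss @ ts)"
  unfolding derivation_def
proof (intro conjI allI impI)
  show "ss @ ts \<noteq> []" "set (ss @ ts) \<subseteq> BN C"
    using assms by (auto simp: derivation_def)
  fix i assume i: "i < length (ss @ ts)"
  show "(ss @ ts) ! i \<in> \<Gamma> \<or> (\<exists>P. d_rule C P ((ss @ ts) ! i) \<and> P \<subseteq> set (take i (ss @ ts)))"
  proof (cases "i < length ss")
    case True
    then show ?thesis using assms(1) by (auto simp: derivation_def nth_append)
  next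
    case False
    then have "i - length ss < length ts" using i by auto
    then have "ts ! (i - length ss) \<in> \<Gamma> \<or>
        (\<exists>P. d_rule C P (ts ! (i - length ss)) \<and> P \<subseteq> set (take (i - length ss) ts))"
      using assms(2) unfolding derivation_def by blast
    then show ?thesis using False by (auto simp: nth_append)
  qed
qed

text \<open>The alternative \<open>ss = []\<close> covers derivations of length one: the empty list
  is not itself a derivation, yet a premise or an instance of A-Id must be able to start
  one.\<close>

lemma derivation_snoc:
  assumes "ss = [] \<or> derivation C \<Gamma> ss" "\<sigma> \<in> BN C"
    and "\<sigma> \<in> \<Gamma> \<or> (\<exists>P. d_rule C P \<sigma> \<and> P \<subseteq> set ss)"
  shows "derivation C \<Gamma> (ss @ [\<sigma>])"
  using assms by (auto simp: derivation_def nth_append less_Suc_eq)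

lemma last_in_derivation: "derivation C \<Gamma> ss \<Longrightarrow> last ss \<in> set ss"
  by (simp add: derivation_def)

lemma derives_premise: "\<sigma> \<in> \<Gamma> \<Longrightarrow> \<Gamma> \<subseteq> BN C \<Longrightarrow> derives C \<Gamma> \<sigma>"
  unfolding derives_def using derivation_snoc[of "[]" C \<Gamma> \<sigma>] by fastforce

lemma derives_rule0:
  assumes "d_rule C {} \<sigma>" "\<sigma> \<in> BN C"
  shows "derives C \<Gamma> \<sigma>"
  unfolding derives_def using derivation_snoc[of "[]" C \<Gamma> \<sigma>] assms by fastforce

lemma derives_rule2:
  assumes "d_rule C {\<rho>, \<tau>} \<sigma>" "\<sigma> \<in> BN C" "derives C \<Gamma> \<rho>" "derives C \<Gamma> \<tau>"
  shows "derives C \<Gamma> \<sigma>"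
proof -
  obtain ss ts where st: "derivation C \<Gamma> ss" "last ss = \<rho>" "derivation C \<Gamma> ts" "last ts = \<tau>"
    using assms(3,4) by (auto simp: derives_def)
  then have "{\<rho>, \<tau>} \<subseteq> set (ss @ ts)"
    using last_in_derivation by fastforce
  then have "derivation C \<Gamma> ((ss @ ts) @ [\<sigma>])"
    using derivation_snoc[of "ss @ ts" C \<Gamma> \<sigma>] derivation_append[OF st(1,3)] assms(1,2) by blast
  then show ?thesis unfolding derives_def by fastforce
qed

lemma derives_rule1:
  assumes "d_rule C {\<rho>} \<sigma>" "\<sigma> \<in> BN C" "derives C \<Gamma> \<rho>"
  shows "derives C \<Gamma> \<sigma>"
  \<comment> \<open>A rule with one premise is the two-premise case with both premises equal, since
    premises form a set.\<close>
  using derives_rule2[of C \<rho> \<rho> \<sigma> \<Gamma>] assms by simp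

section \<open>Soundness of the rules in Leibniz models\<close>

lemma leibniz_rel_trans: "leibniz_rel u v \<Longrightarrow> leibniz_rel v w \<Longrightarrow> leibniz_rel u w"
  by (auto simp: leibniz_rel_def intro: dvd_trans)

lemma leibniz_rel_refl: "leibniz_rel u u"
  by (simp add: leibniz_rel_def)

text \<open>Truth of A-sentences is a preorder and truth of E-sentences is symmetric. For Apc the
  common lower bound is \<open>\<mu> a\<close> itself, which must therefore lie in
  \<open>leibniz_base\<close>. For Celarent a common lower bound of \<open>a\<close> and
  \<open>c\<close> is also one of \<open>b\<close> and \<open>c\<close>.\<close>

lemma d_rule_sound:
  assumes "d_rule C P \<sigma>" "\<forall>\<rho>\<in>P. leibniz_true \<mu> \<rho>" "\<mu> ` C \<subseteq> leibniz_base"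
  shows "leibniz_true \<mu> \<sigma>"
  using assms
proof (cases rule: d_rule.cases)
  case (Apc a b)
  then show ?thesis using assms by (auto intro!: bexI[of _ "\<mu> a"] simp: leibniz_rel_refl)
next
  case (Celarent a b c)
  then show ?thesis using assms by (auto intro: leibniz_rel_trans)
qed (auto simp: leibniz_rel_refl intro: leibniz_rel_trans)

lemma derives_sound:
  assumes "leibniz_model C \<mu> \<Gamma>" "derives C \<Gamma> \<sigma>"
  shows "leibniz_true \<mu> \<sigma>"
proof -
  obtain ss where ss: "derivation C \<Gamma> ss" "last ss = \<sigma>"
    using assms(2) by (auto simp: derives_def)
  have "leibniz_true \<mu> (ss ! i)" if "i < length ss" for i
    using that
  proof (induction i rule: less_induct)
    case (less i)
    consider "ss ! i \<in> \<Gamma>" | P where "d_rule C P (ss ! i)" "P \<subseteq> set (take i ss)"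
      using ss(1) less.prems by (auto simp: derivation_def)
    then show ?case
    proof cases
      case 1
      then show ?thesis using assms(1) by (simp add: leibniz_model_def)
    next
      case 2
      have "leibniz_true \<mu> \<rho>" if "\<rho> \<in> P" for \<rho>
      proof -
        from that 2(2) obtain k where "k < i" "k < length ss" "\<rho> = ss ! k"
          by (fastforce simp: in_set_conv_nth)
        then show ?thesis using less.IH by simp
      qed
      then show ?thesis
        using d_rule_sound[OF 2(1)] assms(1) by (simp add: leibniz_model_def)
    qed
  qed
  then show ?thesis
    using last_in_derivation[OF ss(1)] ss(2) by (metis in_set_conv_nth)
qed

lemma leibniz_model_not_contradictory:
  assumes "leibniz_model C \<mu> \<Gamma>"
  shows "\<not> contradictory C \<Gamma>"
proof
  assume "contradictory C \<Gamma>"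
  then obtain \<sigma> where "leibniz_true \<mu> \<sigma>" "leibniz_true \<mu> (contradictory_of \<sigma>)"
    using derives_sound[OF assms] unfolding contradictory_def by blast
  then show False by (cases \<sigma> rule: contradictory_of.cases) auto
qed


section \<open>A criterion for contradictoriness\<close>

definition arrows :: "'c sentence list \<Rightarrow> ('c \<times> 'c) set" where
  "arrows xs = {(a, b). (YA, a, b) \<in> set xs}"

definition upset :: "'c sentence list \<Rightarrow> 'c set \<Rightarrow> 'c set" where
  "upset xs P = (arrows xs)\<^sup>* `` P"

text \<open>The two ends of the E-sentence may lie above different members of \<open>P\<close>. This
  is what the case \<open>P = {a, b}\<close> for a sentence \<open>Iab\<close> requires; otherwise
  \<open>P\<close> is a singleton.\<close>

definition clash :: "'c sentence list \<Rightarrow> 'c set \<Rightarrow> bool" where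
  "clash xs P \<longleftrightarrow> (\<exists>c d. (YE, c, d) \<in> set xs \<and> c \<in> upset xs P \<and> d \<in> upset xs P)"

definition consts_of :: "'c sentence list \<Rightarrow> 'c set" where
  "consts_of xs = (fst \<circ> snd) ` set xs \<union> (snd \<circ> snd) ` set xs"

text \<open>These are the obstructions to the canonical model: excluding the first puts its values
  into \<open>leibniz_base\<close>, excluding the second makes O-sentences true, excluding the third
  I-sentences. A- and E-sentences hold in it in any case.\<close>

definition conflicting :: "'c sentence list \<Rightarrow> bool" where
  "conflicting xs \<longleftrightarrow>
     (\<exists>c\<in>consts_of xs. clash xs {c}) \<or>
     (\<exists>a b. (YO, a, b) \<in> set xs \<and> b \<in> upset xs {a}) \<or>
     (\<exists>a b. (YI, a, b) \<in> set xs \<and> clash xs {a, b})"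

lemma upset_insert: "upset xs (insert a P) = upset xs {a} \<union> upset xs P"
  by (auto simp: upset_def)

lemma subset_upset: "P \<subseteq> upset xs P"
  by (auto simp: upset_def)

text \<open>A path of arrows is turned into a derivation by starting with A-Id and applying Barbara
  once per arrow.\<close>

lemma derives_upset:
  assumes "set xs \<subseteq> \<Gamma>" "\<Gamma> \<subseteq> BN C" "a \<in> C" "b \<in> upset xs {a}"
  shows "derives C \<Gamma> (YA, a, b) \<and> b \<in> C"
proof -
  have "(a, b) \<in> (arrows xs)\<^sup>*" using assms(4) by (simp add: upset_def)
  then show ?thesis
  proof induction
    case base
    then show ?case using assms(3) derives_rule0[OF A_Id] by (fastforce simp: BN_def)
  next
    case (step b c)
    have "(YA, b, c) \<in> \<Gamma>" using step.hyps(2) assms(1) by (auto simp: arrows_def)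
    then have "derives C \<Gamma> (YA, b, c)" "c \<in> C"
      using assms(2) derives_premise by (auto simp: BN_def)
    then show ?case
      using derives_rule2[OF Barbara[of a C b c]] step.IH assms(3) by (fastforce simp: BN_def)
  qed
qed

text \<open>Celarent replaces only the first term of an E-sentence. So the sentence is lowered on
  the left, turned around by Ec, lowered on the left again, and turned back.\<close>

lemma derives_disjoint:
  assumes "set xs \<subseteq> \<Gamma>" "\<Gamma> \<subseteq> BN C" "a \<in> C" "b \<in> C"
    and "derives C \<Gamma> (YE, c, d)" "c \<in> upset xs {a}" "d \<in> upset xs {b}"
  shows "derives C \<Gamma> (YE, a, b)"
proof -
  have c: "derives C \<Gamma> (YA, a, c)" "c \<in> C" and d: "derives C \<Gamma> (YA, b, d)" "d \<in> C"
    using derives_upset[OF assms(1,2,3,6)] derives_upset[OF assms(1,2,4,7)] by auto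
  have "derives C \<Gamma> (YE, a, d)"
    using derives_rule2[OF Celarent[of a C c d]] assms c d by (simp add: BN_def)
  then have "derives C \<Gamma> (YE, d, a)"
    using derives_rule1[OF Ec[of a C d]] assms d by (simp add: BN_def)
  then have "derives C \<Gamma> (YE, b, a)"
    using derives_rule2[OF Celarent[of b C d a]] assms d by (simp add: BN_def)
  then show ?thesis
    using derives_rule1[OF Ec[of b C a]] assms by (simp add: BN_def)
qed

text \<open>A-Id followed by Apc yields \<open>Iaa\<close>, the contradictory of
  \<open>Eaa\<close>.\<close>

lemma contradictory_disjoint_self:
  assumes "derives C \<Gamma> (YE, a, a)" "a \<in> C"
  shows "contradictory C \<Gamma>"
proof -
  have "derives C \<Gamma> (YA, a, a)" using assms(2) derives_rule0[OF A_Id] by (fastforce simp: BN_def)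
  then have "derives C \<Gamma> (YI, a, a)"
    using assms(2) derives_rule1[OF Apc[of a C a]] by (simp add: BN_def)
  then show ?thesis
    using assms unfolding contradictory_def
    by (intro bexI[of _ "(YE, a, a)"]) (auto simp: BN_def)
qed

lemma conflicting_imp_contradictory:
  assumes "set xs \<subseteq> \<Gamma>" "\<Gamma> \<subseteq> BN C" "conflicting xs"
  shows "contradictory C \<Gamma>"
proof -
  note D = derives_disjoint[OF assms(1,2)]
  have prem: "derives C \<Gamma> (Y, a, b) \<and> a \<in> C \<and> b \<in> C" if "(Y, a, b) \<in> set xs" for Y a b
    using derives_premise[OF _ assms(2)] that assms(1,2) unfolding BN_def by blast
  have Esym: "derives C \<Gamma> (YE, d, c)" if "(YE, c, d) \<in> set xs" for c d
    using prem[OF that] derives_rule1[OF Ec[of c C d]] by (simp add: BN_def)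
  have inC: "c \<in> C" if "c \<in> consts_of xs" for c
    using that assms(1,2) by (auto simp: BN_def consts_of_def)
  from assms(3) consider
      a where "a \<in> C" "clash xs {a}"
    | a b where "(YO, a, b) \<in> set xs" "b \<in> upset xs {a}"
    | a b where "(YI, a, b) \<in> set xs" "clash xs {a, b}"
    unfolding conflicting_def using inC by blast
  then show ?thesis
  proof cases
    case 1
    then obtain c d where "(YE, c, d) \<in> set xs" "c \<in> upset xs {a}" "d \<in> upset xs {a}"
      by (auto simp: clash_def)
    then have "derives C \<Gamma> (YE, a, a)" using D[OF 1(1) 1(1)] prem by metis
    then show ?thesis using contradictory_disjoint_self 1(1) by metis
  next
    case 2
    then have "derives C \<Gamma> (YA, a, b)" using derives_upset[OF assms(1,2)] prem by blast
    then show ?thesis using prem[OF 2(1)] unfolding contradictory_def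
      by (intro bexI[of _ "(YO, a, b)"]) (auto simp: BN_def)
  next
    case 3
    then obtain c d where cd: "(YE, c, d) \<in> set xs"
      "c \<in> upset xs {a} \<union> upset xs {b}" "d \<in> upset xs {a} \<union> upset xs {b}"
      unfolding clash_def upset_insert[of xs a "{b}"] by blast
    have ab: "a \<in> C" "b \<in> C" "derives C \<Gamma> (YI, a, b)" using prem[OF 3(1)] by auto
    \<comment> \<open>Each end of the E-sentence is above \<open>a\<close> or above
      \<open>b\<close>. If both are above the same constant, that constant is disjoint from itself;
      otherwise \<open>Eab\<close> contradicts \<open>Iab\<close>. When \<open>d\<close> is above
      \<open>a\<close> and \<open>c\<close> above \<open>b\<close>, the sentence is first turned
      around by Ec.\<close>
    from cd(2,3) consider "c \<in> upset xs {a}" "d \<in> upset xs {a}"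
      | "c \<in> upset xs {b}" "d \<in> upset xs {b}"
      | "c \<in> upset xs {a}" "d \<in> upset xs {b}"
      | "d \<in> upset xs {a}" "c \<in> upset xs {b}" by blast
    then consider "derives C \<Gamma> (YE, a, a)" | "derives C \<Gamma> (YE, b, b)" | "derives C \<Gamma> (YE, a, b)"
    proof cases
      case 1
      then show ?thesis using that(1) D[OF ab(1,1), of c d] prem[OF cd(1)] by simp
    next
      case 2
      then show ?thesis using that(2) D[OF ab(2,2), of c d] prem[OF cd(1)] by simp
    next
      case 3
      then show ?thesis using that(3) D[OF ab(1,2), of c d] prem[OF cd(1)] by simp
    next
      case 4
      then show ?thesis using that(3) D[OF ab(1,2), of d c] Esym[OF cd(1)] by simp
    qed
    then show ?thesis
    proof cases
      case 3
      then show ?thesis unfolding contradictory_def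
        using ab by (intro bexI[of _ "(YI, a, b)"]) (auto simp: BN_def)
    qed (use ab contradictory_disjoint_self in metis)+
  qed
qed


section \<open>Pairwise coprime factors and the canonical model\<close>

definition factor :: "nat \<Rightarrow> nat \<Rightarrow> nat" where
  "factor n i = 1 + (i + 1) * fact n"

lemma factor_gt_1: "factor n i > 1"
  by (simp add: factor_def)

text \<open>A common divisor \<open>d\<close> is prime to \<open>n!\<close>, because it divides one
  more than a multiple of \<open>n!\<close>. It divides the difference \<open>(j - i) * n!\<close>,
  hence \<open>j - i\<close>, hence \<open>n!\<close>, since \<open>j - i \<le> n\<close>. So
  \<open>d\<close> divides 1.\<close>

lemma coprime_factor_aux:
  assumes "i < j" "j < n"
  shows "coprime (factor n i) (factor n j)"
proof (rule coprimeI)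
  fix d assume d: "d dvd factor n i" "d dvd factor n j"
  have "coprime d (fact n)"
  proof (rule coprimeI)
    fix e assume "e dvd d" "e dvd fact n"
    then have "e dvd 1 + (i + 1) * fact n" "e dvd (i + 1) * fact n"
      using d(1) by (auto simp: factor_def intro: dvd_trans)
    then show "is_unit e" by (metis dvd_add_left_iff)
  qed
  moreover have "factor n j - factor n i = (j - i) * fact n"
    using assms(1) by (simp add: factor_def algebra_simps)
  then have "d dvd (j - i) * fact n" using d by (metis dvd_diff_nat)
  ultimately have "d dvd j - i" by (simp add: coprime_dvd_mult_left_iff)
  also have "j - i dvd fact n" using assms by (intro dvd_fact) auto
  finally have "d dvd (i + 1) * fact n" by simp
  then show "is_unit d" using d(1) unfolding factor_def by (metis dvd_add_left_iff)
qed

lemma coprime_factor: "i < n \<Longrightarrow> j < n \<Longrightarrow> i \<noteq> j \<Longrightarrow> coprime (factor n i) (factor n j)"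
  using coprime_factor_aux coprime_commute by (metis nat_neq_iff)

section \<open>Products of selected factors\<close>

definition factor_prod :: "nat \<Rightarrow> (nat \<Rightarrow> bool) \<Rightarrow> nat" where
  "factor_prod n Q = (\<Prod>i<n. if Q i then factor n i else 1)"

text \<open>If \<open>j\<close> is not selected, every term of the product is coprime to
  \<open>factor n j\<close>, which exceeds 1 and so cannot divide it. Thus the product encodes
  exactly which indices were selected.\<close>

lemma factor_dvd_factor_prod_iff:
  assumes "j < n"
  shows "factor n j dvd factor_prod n Q \<longleftrightarrow> Q j"
proof
  assume "Q j"
  then show "factor n j dvd factor_prod n Q"
    unfolding factor_prod_def using assms dvd_prodI[of "{..<n}" j "\<lambda>i. if Q i then factor n i else 1"]
    by simp
next
  assume dvd: "factor n j dvd factor_prod n Q"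
  show "Q j"
  proof (rule ccontr)
    assume "\<not> Q j"
    then have "coprime (factor n j) (factor_prod n Q)"
      unfolding factor_prod_def using assms by (intro prod_coprime_right) (auto intro: coprime_factor)
    then show False using dvd factor_gt_1[of n j] by (simp add: coprime_absorb_left)
  qed
qed

text \<open>Nontrivial terms of the two products always have different indices, so they are coprime
  pairwise.\<close>

lemma coprime_factor_prod:
  assumes "\<And>i. i < n \<Longrightarrow> \<not> (Q i \<and> R i)"
  shows "coprime (factor_prod n Q) (factor_prod n R)"
  unfolding factor_prod_def
proof (intro prod_coprime_left prod_coprime_right)
  fix i j assume "i \<in> {..<n}" "j \<in> {..<n}"
  then show "coprime (if Q i then factor n i else 1) (if R j then factor n j else 1)"
    using assms coprime_factor by auto
qed

lemma factor_prod_dvd: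
  assumes "\<And>i. i < n \<Longrightarrow> Q i \<Longrightarrow> R i"
  shows "factor_prod n Q dvd factor_prod n R"
  unfolding factor_prod_def using assms by (intro prod_dvd_prod) auto

section \<open>The canonical assignment of pairs of products\<close>

definition first_in :: "'c sentence list \<Rightarrow> 'c set \<Rightarrow> nat \<Rightarrow> bool" where
  "first_in xs S i \<longleftrightarrow> fst (xs ! i) = YE \<and> fst (snd (xs ! i)) \<in> S"

text \<open>Unlike in \<open>first_in\<close>, the symbol is not restricted to E: a sentence
  \<open>Oab\<close> has its own factor in the right component of \<open>b\<close>, and this factor
  separates \<open>b\<close> from \<open>a\<close>.\<close>

definition second_in :: "'c sentence list \<Rightarrow> 'c set \<Rightarrow> nat \<Rightarrow> bool" where
  "second_in xs S i \<longleftrightarrow> snd (snd (xs ! i)) \<in> S"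

definition left_val :: "'c sentence list \<Rightarrow> 'c \<Rightarrow> nat" where
  "left_val xs c = factor_prod (length xs) (first_in xs (upset xs {c}))"

definition right_val :: "'c sentence list \<Rightarrow> 'c \<Rightarrow> nat" where
  "right_val xs c = factor_prod (length xs) (second_in xs (upset xs {c}))"

text \<open>The default \<open>(1, 1)\<close> is an element of \<open>leibniz_base\<close> and
  serves as the fixed value \<open>b0\<close> in the theorem.\<close>

definition canonical :: "'c sentence list \<Rightarrow> 'c \<Rightarrow> nat \<times> nat" where
  "canonical xs c = (if c \<in> consts_of xs then (left_val xs c, right_val xs c) else (1, 1))"

text \<open>An index selected in both products would be that of an E-sentence with its first
  constant above \<open>a\<close> and its second above \<open>b\<close>, which is a clash of
  \<open>P\<close>. The case \<open>a = b\<close> is about a single value, the case of different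
  constants about I-sentences.\<close>

lemma coprime_values:
  assumes "\<not> clash xs P" "a \<in> P" "b \<in> P"
  shows "coprime (left_val xs a) (right_val xs b)"
  unfolding left_val_def right_val_def
proof (rule coprime_factor_prod)
  fix i assume "i < length xs"
  then have "xs ! i \<in> set xs" by simp
  moreover have "upset xs {a} \<subseteq> upset xs P" "upset xs {b} \<subseteq> upset xs P"
    using assms by (auto simp: upset_def)
  ultimately show "\<not> (first_in xs (upset xs {a}) i \<and> second_in xs (upset xs {b}) i)"
    using assms(1) unfolding clash_def first_in_def second_in_def by (metis prod.collapse subsetD)
qed

lemma canonical_in_base:
  assumes "\<not> conflicting xs"
  shows "canonical xs c \<in> leibniz_base"
  using assms coprime_values[of xs "{c}" c c]
  by (auto simp: canonical_def leibniz_base_def conflicting_def)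

lemma canonical_true:
  assumes nc: "\<not> conflicting xs" and mem: "(Y, a, b) \<in> set xs"
  shows "leibniz_true (canonical xs) (Y, a, b)"
proof -
  obtain j where j: "j < length xs" "xs ! j = (Y, a, b)"
    using mem by (auto simp: in_set_conv_nth)
  have "a \<in> consts_of xs" "b \<in> consts_of xs"
    using mem unfolding consts_of_def by force+
  then have val: "canonical xs a = (left_val xs a, right_val xs a)"
    "canonical xs b = (left_val xs b, right_val xs b)"
    by (auto simp: canonical_def)
  show ?thesis
  proof (cases Y)
    case YA
    \<comment> \<open>Whatever is above \<open>b\<close> is above \<open>a\<close>, so every factor
      in a component of the value of \<open>b\<close> also occurs in that of
      \<open>a\<close>.\<close>
    then have "upset xs {b} \<subseteq> upset xs {a}"
      using mem by (auto simp: upset_def arrows_def intro: converse_rtrancl_into_rtrancl)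
    then show ?thesis
      unfolding YA leibniz_true.simps leibniz_rel_def val left_val_def right_val_def
      by (auto intro!: factor_prod_dvd simp: first_in_def second_in_def)
  next
    case YE
    \<comment> \<open>The factor of the sentence \<open>Eab\<close> itself divides the left
      component of \<open>a\<close> and the right component of \<open>b\<close>. A common lower
      bound would have both components divisible by it and hence not be coprime.\<close>
    have dvd: "factor (length xs) j dvd left_val xs a" "factor (length xs) j dvd right_val xs b"
      unfolding left_val_def right_val_def factor_dvd_factor_prod_iff[OF j(1)]
      using j YE subset_upset[of "{a}" xs] subset_upset[of "{b}" xs]
      by (auto simp: first_in_def second_in_def)
    have "False" if x: "x \<in> leibniz_base" "leibniz_rel x (canonical xs a)"
      "leibniz_rel x (canonical xs b)" for x
    proof -
      have "factor (length xs) j dvd gcd (fst x) (snd x)"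
        using dvd x(2,3) unfolding leibniz_rel_def val by (auto intro: dvd_trans)
      moreover have "gcd (fst x) (snd x) = 1" using x(1) by (auto simp: leibniz_base_def)
      ultimately show False using factor_gt_1[of "length xs" j] by simp
    qed
    then show ?thesis unfolding YE leibniz_true.simps by blast
  next
    case YI
    then have "\<not> clash xs {a, b}" using nc mem by (auto simp: conflicting_def)
    \<comment> \<open>The common lower bound is the componentwise product of the two values. It is
      in \<open>leibniz_base\<close> because all four pairings of a left with a right component are
      coprime.\<close>
    from coprime_values[OF this]
    have "coprime (left_val xs a * left_val xs b) (right_val xs a * right_val xs b)"
      by simp
    then show ?thesis unfolding YI leibniz_true.simps leibniz_rel_def val
      by (intro bexI[of _ "(left_val xs a * left_val xs b, right_val xs a * right_val xs b)"])
        (auto simp: leibniz_base_def)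
  next
    case YO
    then have "b \<notin> upset xs {a}" using nc mem by (auto simp: conflicting_def)
    moreover have "b \<in> upset xs {b}" by (simp add: upset_def)
    \<comment> \<open>The factor of the sentence \<open>Oab\<close> itself occurs on the right
      exactly for the constants with \<open>b\<close> above them.\<close>
    ultimately have "factor (length xs) j dvd right_val xs b"
      "\<not> factor (length xs) j dvd right_val xs a"
      unfolding right_val_def factor_dvd_factor_prod_iff[OF j(1)] by (auto simp: second_in_def j(2))
    then have "\<not> right_val xs b dvd right_val xs a" using dvd_trans by blast
    then show ?thesis by (simp add: YO leibniz_rel_def val)
  qed
qed

section \<open>From the input list back to the whole of \<open>\<Gamma>\<close>\<close>

lemma consts_of_linked:
  assumes "set xs = \<Gamma> \<inter> BN (linked_consts \<Gamma>)"
  shows "consts_of xs = linked_consts \<Gamma>"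
proof
  show "consts_of xs \<subseteq> linked_consts \<Gamma>"
    unfolding consts_of_def assms by (auto simp: BN_def)
  show "linked_consts \<Gamma> \<subseteq> consts_of xs"
  proof
    fix c assume "c \<in> linked_consts \<Gamma>"
    then obtain Y a b where ab: "(Y, a, b) \<in> \<Gamma>" "a \<noteq> b" "c = a \<or> c = b"
      by (auto simp: linked_consts_def)
    then have "a \<in> linked_consts \<Gamma>" "b \<in> linked_consts \<Gamma>"
      unfolding linked_consts_def by blast+
    then have "(Y, a, b) \<in> set xs" unfolding assms using ab(1) by (simp add: BN_def)
    then show "c \<in> consts_of xs" using ab(3) unfolding consts_of_def by force
  qed
qed

text \<open>A sentence of \<open>\<Gamma>\<close> missing from the list contains a constant that is
  not linked, so its two constants coincide. As \<open>\<Gamma>\<close> is not plainly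
  contradictory, it is \<open>Aaa\<close> or \<open>Iaa\<close>, which holds by reflexivity once the
  value of \<open>a\<close> is in \<open>leibniz_base\<close>.\<close>

lemma canonical_model:
  assumes xs: "set xs = \<Gamma> \<inter> BN (linked_consts \<Gamma>)" and "\<Gamma> \<subseteq> BN C"
    and npc: "\<not> plainly_contradictory C \<Gamma>" and nc: "\<not> conflicting xs"
  shows "leibniz_model C (canonical xs) \<Gamma>"
  unfolding leibniz_model_def
proof (intro conjI ballI)
  show "canonical xs ` C \<subseteq> leibniz_base" using canonical_in_base[OF nc] by blast
  fix \<sigma> assume \<sigma>: "\<sigma> \<in> \<Gamma>"
  obtain Y a b where Yab: "\<sigma> = (Y, a, b)" by (cases \<sigma>)
  show "leibniz_true (canonical xs) \<sigma>"
  proof (cases "\<sigma> \<in> set xs")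
    case True
    then show ?thesis using canonical_true[OF nc] Yab by blast
  next
    case False
    then have "a \<notin> linked_consts \<Gamma> \<or> b \<notin> linked_consts \<Gamma>"
      using \<sigma> unfolding xs Yab by (simp add: BN_def)
    then have "a = b"
      using \<sigma> unfolding Yab linked_consts_def by blast
    moreover have "a \<in> C" using \<sigma> Yab assms(2) by (auto simp: BN_def)
    ultimately have "Y = YA \<or> Y = YI"
      using npc \<sigma> Yab by (cases Y) (auto simp: plainly_contradictory_def)
    then show ?thesis unfolding Yab \<open>a = b\<close>[symmetric]
      using canonical_in_base[OF nc, of a] leibniz_rel_refl[of "canonical xs a"]
      by (elim disjE) (auto intro!: bexI[of _ "canonical xs a"])
  qed
qed


section \<open>Timed correctness of programs\<close>

fun writes :: "com \<Rightarrow> string set" where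
  "writes SKIP = {}"
| "writes (Assign x i e) = {x}"
| "writes (Seq c1 c2) = writes c1 \<union> writes c2"
| "writes (IF b c1 c2) = writes c1 \<union> writes c2"
| "writes (WHILE b c) = writes c"

definition agree_off :: "string set \<Rightarrow> 'c state \<Rightarrow> 'c state \<Rightarrow> bool" where
  "agree_off X s s' \<longleftrightarrow> (\<forall>x. x \<notin> X \<longrightarrow> s' x = s x)"

text \<open>A total-correctness triple with an upper bound \<open>T\<close> on the time. Because
  execution is deterministic, the existential form speaks of the only execution there is.\<close>

definition runs :: "com \<Rightarrow> 'c state \<Rightarrow> nat \<Rightarrow> ('c state \<Rightarrow> bool) \<Rightarrow> bool" where
  "runs c s T Q \<longleftrightarrow> (\<exists>t s'. exec c s t s' \<and> t \<le> T \<and> Q s')"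

abbreviation upd :: "'c state \<Rightarrow> string \<Rightarrow> nat \<Rightarrow> 'c val \<Rightarrow> 'c state" where
  "upd s x i v \<equiv> s(x := (s x)(i := v))"

lemma agree_offD: "agree_off X s s' \<Longrightarrow> x \<notin> X \<Longrightarrow> s' x = s x"
  by (simp add: agree_off_def)

lemma agree_off_refl: "agree_off X s s"
  by (simp add: agree_off_def)

lemma agree_off_trans: "agree_off X s s' \<Longrightarrow> agree_off X s' s'' \<Longrightarrow> agree_off X s s''"
  by (simp add: agree_off_def)

lemma agree_off_mono: "agree_off X s s' \<Longrightarrow> X \<subseteq> Y \<Longrightarrow> agree_off Y s s'"
  by (auto simp: agree_off_def)

lemma agree_off_upd: "agree_off X s s' \<Longrightarrow> x \<in> X \<Longrightarrow> agree_off X s (upd s' x i v)"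
  by (auto simp: agree_off_def)

lemma exec_writes: "exec c s t s' \<Longrightarrow> agree_off (writes c) s s'"
  by (induction rule: exec.induct) (auto simp: agree_off_def)

text \<open>The frame is supplied by the rule: in weakening the postcondition one may use that
  arrays not written by \<open>c\<close> are unchanged. Facts about the input and earlier results
  are carried along in this way.\<close>

lemma runs_conseq:
  assumes "runs c s T Q" "\<And>s'. agree_off (writes c) s s' \<Longrightarrow> Q s' \<Longrightarrow> R s'" "T \<le> U"
  shows "runs c s U R"
  using assms exec_writes unfolding runs_def by (meson order_trans)

lemma runs_mono: "runs c s T Q \<Longrightarrow> T \<le> U \<Longrightarrow> runs c s U Q"
  by (rule runs_conseq)

lemma runs_Assign: "1 \<le> T \<Longrightarrow> Q (upd s x (num (aval i s)) (aval e s)) \<Longrightarrow> runs (Assign x i e) s T Q"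
  unfolding runs_def using exec.Assign by blast

lemma runs_Seq: "runs c1 s T1 (\<lambda>s'. runs c2 s' T2 Q) \<Longrightarrow> runs (Seq c1 c2) s (T1 + T2) Q"
  unfolding runs_def by (meson exec.Seq add_mono)

lemma runs_Seq_frame:
  assumes "runs c1 s T1 P" "\<And>s'. agree_off (writes c1) s s' \<Longrightarrow> P s' \<Longrightarrow> runs c2 s' T2 Q"
  shows "runs (Seq c1 c2) s (T1 + T2) Q"
  by (rule runs_Seq, rule runs_conseq[OF assms(1) assms(2)]) auto

lemma runs_Assign_Seq:
  assumes "runs c (upd s x (num (aval i s)) (aval e s)) T Q"
  shows "runs (Seq (Assign x i e) c) s (1 + T) Q"
  using assms by (intro runs_Seq runs_Assign order_refl)

abbreviation var :: "string \<Rightarrow> aexp" where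
  "var x \<equiv> Cell x (NumLit 0)"

abbreviation set_var :: "string \<Rightarrow> aexp \<Rightarrow> com" where
  "set_var x e \<equiv> Assign x (NumLit 0) e"

text \<open>Conditions of the language have no conjunction, so a conjunction of tests is a nest of
  conditionals, each costing one step.\<close>

fun guarded :: "cond list \<Rightarrow> com \<Rightarrow> com" where
  "guarded [] c = c"
| "guarded (b # bs) c = IF b (guarded bs c) SKIP"

lemma writes_guarded [simp]: "writes (guarded bs c) = writes c"
  by (induction bs) auto

lemma runs_guarded:
  assumes "(\<forall>b\<in>set bs. holds b s) \<Longrightarrow> runs c s T Q" "\<not> (\<forall>b\<in>set bs. holds b s) \<Longrightarrow> Q s"
  shows "runs (guarded bs c) s (length bs + T) Q"
  using assms
proof (induction bs)
  case (Cons b bs)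
  show ?case
  proof (cases "holds b s")
    case True
    with Cons have "runs (guarded bs c) s (length bs + T) Q" by auto
    then obtain t s' where "exec (guarded bs c) s t s'" "t \<le> length bs + T" "Q s'"
      by (auto simp: runs_def)
    with exec.IfTrue[OF True] show ?thesis unfolding runs_def by fastforce
  next
    case False
    with exec.IfFalse[OF False exec.Skip] Cons.prems show ?thesis unfolding runs_def by fastforce
  qed
qed auto

definition FOR :: "string \<Rightarrow> aexp \<Rightarrow> com \<Rightarrow> com" where
  "FOR x e c = Seq (set_var x (NumLit 0))
     (WHILE (Less (var x) e) (Seq c (set_var x (Plus (var x) (NumLit 1)))))"

lemma writes_FOR [simp]: "writes (FOR x e c) = insert x (writes c)"
  by (auto simp: FOR_def)

text \<open>A round costs the body plus one comparison and one increment, hence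
  \<open>T + 2\<close>; the initialization and the final failing comparison account for the last 2.
  The limit is evaluated anew in each round, so it must keep its value under all changes made by the
  body. The invariant is required after the increment of the counter.\<close>

lemma runs_FOR:
  assumes x: "x \<notin> writes c"
    and bound: "\<And>s'. agree_off (insert x (writes c)) s s' \<Longrightarrow> num (aval e s') = N"
    and init: "J 0 (upd s x 0 (Num 0))"
    and step: "\<And>k s'. k < N \<Longrightarrow> agree_off (insert x (writes c)) s s' \<Longrightarrow> s' x 0 = Num k \<Longrightarrow> J k s'
      \<Longrightarrow> runs c s' T (\<lambda>s''. J (Suc k) (upd s'' x 0 (Num (Suc k))))"
  shows "runs (FOR x e c) s (N * (T + 2) + 2) (J N)"
proof -
  let ?c = "Seq c (set_var x (Plus (var x) (NumLit 1)))"
  let ?W = "WHILE (Less (var x) e) ?c"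
  have loop: "runs ?W s' ((N - k) * (T + 2) + 1) (J N)"
    if "k \<le> N" "agree_off (insert x (writes c)) s s'" "s' x 0 = Num k" "J k s'" for k s'
    using that
  \<comment> \<open>The induction descends from \<open>k = N\<close>, where the loop stops, to
    smaller values of the counter.\<close>
  proof (induction arbitrary: s' rule: inc_induct)
    case base
    then have "\<not> holds (Less (var x) e) s'" using bound by simp
    then have "exec ?W s' 1 s'" by (rule exec.WhileFalse)
    then show ?case using base.prems(3) unfolding runs_def by (metis diff_self_eq_0 le_refl mult_0 add_0)
  next
    case (step k)
    from assms(4)[OF step.hyps(2) step.prems] obtain t1 s1 where
      s1: "exec c s' t1 s1" "t1 \<le> T" "J (Suc k) (upd s1 x 0 (Num (Suc k)))"
      by (auto simp: runs_def)
    let ?s2 = "upd s1 x 0 (Num (Suc k))"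
    have "s1 x = s' x" using exec_writes[OF s1(1)] x by (rule agree_offD)
    then have c: "exec ?c s' (t1 + 1) ?s2"
      using exec.Seq[OF s1(1) exec.Assign[of x "NumLit 0" "Plus (var x) (NumLit 1)" s1]] step.prems(2)
      by simp
    have "agree_off (insert x (writes c)) s' s1"
      using exec_writes[OF s1(1)] by (rule agree_off_mono) auto
    then have "agree_off (insert x (writes c)) s ?s2"
      using agree_off_trans[OF step.prems(1)] agree_off_upd by blast
    then have "runs ?W ?s2 ((N - Suc k) * (T + 2) + 1) (J N)"
      by (rule step.IH[OF _ _ s1(3)]) simp
    then obtain t3 s3 where s3: "exec ?W ?s2 t3 s3" "t3 \<le> (N - Suc k) * (T + 2) + 1" "J N s3"
      by (auto simp: runs_def)
    have "holds (Less (var x) e) s'" using bound step.prems step.hyps by simp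
    from exec.WhileTrue[OF this c s3(1)]
    have "exec ?W s' (1 + (t1 + 1) + t3) s3" .
    moreover have "(N - k) * (T + 2) = (N - Suc k) * (T + 2) + (T + 2)"
      using step.hyps(2) by (metis Suc_diff_Suc add.commute mult_Suc)
    then have "1 + (t1 + 1) + t3 \<le> (N - k) * (T + 2) + 1" using s1(2) s3(2) by linarith
    ultimately show ?case using s3(3) unfolding runs_def by blast
  qed
  have "runs ?W (upd s x 0 (Num 0)) (N * (T + 2) + 1) (J N)"
    using loop[of 0 "upd s x 0 (Num 0)"] init by (simp add: agree_off_upd[OF agree_off_refl])
  then have "runs (FOR x e c) s (1 + (N * (T + 2) + 1)) (J N)"
    unfolding FOR_def by (intro runs_Assign_Seq) simp
  then show ?thesis by simp
qed

section \<open>Polynomial time bounds in powers of \<open>n + 1\<close>\<close>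

definition npow :: "nat \<Rightarrow> nat \<Rightarrow> nat" where
  "npow n k = (n + 1) ^ k"

lemma npow_ge_1: "1 \<le> npow n k"
  by (simp add: npow_def)

lemma npow_mono: "i \<le> j \<Longrightarrow> npow n i \<le> npow n j"
  unfolding npow_def by (rule power_increasing) auto

lemma npow_1 [simp]: "npow n (Suc 0) = n + 1"
  by (simp add: npow_def)

lemma npow_ge_n: "1 \<le> k \<Longrightarrow> n + 1 \<le> npow n k"
  using npow_mono[of 1 k n] by simp

text \<open>A loop raises the exponent by one. Powers of \<open>n + 1\<close> are at least 1 even
  for \<open>n = 0\<close>, so additive constants are absorbed: \<open>T + 2\<close> into the
  coefficient \<open>K + 2\<close>, and the final 2 into the step from \<open>n\<close> to
  \<open>n + 1\<close>. The number \<open>c\<close> is 1 for loops over sentences and 2 for loops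
  over nodes.\<close>

lemma runs_loop_time:
  assumes runs: "runs com s (N * (T + 2) + 2) Q"
    and T: "T \<le> K * npow n k" and N: "N \<le> c * n" and c: "1 \<le> c"
    and k': "k' = k + 1" and L: "c * (K + 2) \<le> L"
  shows "runs com s (L * npow n k') Q"
proof -
  have T2: "T + 2 \<le> (K + 2) * npow n k"
    using T npow_ge_1[of n k] unfolding add_mult_distrib by linarith
  have "N * (T + 2) \<le> c * n * ((K + 2) * npow n k)"
    using N T2 by (rule mult_mono) auto
  moreover have "2 \<le> c * ((K + 2) * npow n k)"
    using mult_le_mono[of 1 c 2 "(K + 2) * npow n k"] c T2 by simp
  ultimately have "N * (T + 2) + 2 \<le> c * (K + 2) * npow n k'"
    by (simp add: npow_def k' algebra_simps)
  also have "\<dots> \<le> L * npow n k'" using L by (rule mult_right_mono) simp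
  finally show ?thesis by (rule runs_mono[OF runs])
qed


section \<open>The program\<close>

definition times_com :: "string \<Rightarrow> com" where
  "times_com w = Seq (set_var ''z'' (var ''y''))
     (Seq (FOR ''l'' (var w) (set_var ''z'' (Plus (var ''z'') (var ''y''))))
       (set_var ''y'' (var ''z'')))"

lemma writes_times_com [simp]: "writes (times_com w) = {''l'', ''y'', ''z''}"
  by (auto simp: times_com_def)

text \<open>The accumulator \<open>z\<close> starts with a copy of \<open>y\<close>, so
  \<open>k\<close> additions multiply by \<open>k + 1\<close>. This shift suits counters starting at
  0: they contribute the terms \<open>k + 1\<close> of \<open>n!\<close> and the
  \<open>j + 1\<close> of \<open>factor n j\<close>.\<close>

lemma runs_times_com:
  fixes s :: "'c state"
  assumes "s ''y'' 0 = Num a" "s w 0 = Num k" "w \<notin> {''l'', ''y'', ''z''}"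
  shows "runs (times_com w) s (3 * k + 4) (\<lambda>s'. s' ''y'' 0 = Num ((k + 1) * a))"
proof -
  let ?s = "upd s ''z'' 0 (Num a)"
  have "runs (FOR ''l'' (var w) (set_var ''z'' (Plus (var ''z'') (var ''y'')))) ?s (k * (1 + 2) + 2)
      (\<lambda>s'. s' ''z'' 0 = Num ((k + 1) * a))"
  proof (rule runs_FOR[where J = "\<lambda>l (s' :: 'c state). s' ''z'' 0 = Num ((l + 1) * a)"])
    fix l and s' :: "'c state" assume ag: "agree_off (insert ''l'' (writes (set_var ''z'' (Plus (var ''z'') (var ''y''))))) ?s s'"
      and "s' ''z'' 0 = Num ((l + 1) * a)"
    moreover have "s' ''y'' 0 = Num a" using agree_offD[OF ag, of "''y''"] assms by simp
    ultimately show "runs (set_var ''z'' (Plus (var ''z'') (var ''y''))) s' 1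
        (\<lambda>s''. upd s'' ''l'' 0 (Num (Suc l)) ''z'' 0 = Num ((Suc l + 1) * a))"
      by (intro runs_Assign) simp_all
  qed (use assms in \<open>auto simp: agree_off_def\<close>)
  then have "runs (Seq (FOR ''l'' (var w) (set_var ''z'' (Plus (var ''z'') (var ''y''))))
      (set_var ''y'' (var ''z''))) ?s ((k * (1 + 2) + 2) + 1) (\<lambda>s'. s' ''y'' 0 = Num ((k + 1) * a))"
    by (rule runs_Seq_frame) (auto intro!: runs_Assign)
  then have "runs (times_com w) s (1 + ((k * (1 + 2) + 2) + 1)) (\<lambda>s'. s' ''y'' 0 = Num ((k + 1) * a))"
    unfolding times_com_def using assms(1) by (intro runs_Assign_Seq) simp
  then show ?thesis by (rule runs_conseq) auto
qed

text \<open>The product of \<open>x\<close> and \<open>factor n j\<close> is computed as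
  \<open>x + (j + 1) * n! * x\<close>. The multiplier itself is never formed: \<open>y\<close>
  starts as a copy of \<open>x\<close> and is multiplied in turn by \<open>1, ..., n\<close> and by
  \<open>j + 1\<close>.\<close>

definition multiply_com :: com where
  "multiply_com = Seq (set_var ''y'' (var ''x''))
     (Seq (FOR ''k'' (var ''n'') (times_com ''k''))
       (Seq (times_com ''j'') (set_var ''x'' (Plus (var ''x'') (var ''y'')))))"

lemma writes_multiply_com [simp]: "writes multiply_com = {''k'', ''l'', ''x'', ''y'', ''z''}"
  by (auto simp: multiply_com_def)

lemma runs_multiply_com:
  fixes s :: "'c state"
  assumes "s ''n'' 0 = Num n" "s ''j'' 0 = Num j" "s ''x'' 0 = Num a" "j < n"
  shows "runs multiply_com s (12 * npow n 2) (\<lambda>s'. s' ''x'' 0 = Num (a * factor n j))"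
proof -
  let ?s = "upd s ''y'' 0 (Num a)"
  have "runs (FOR ''k'' (var ''n'') (times_com ''k'')) ?s (n * (4 * (n + 1) + 2) + 2)
      (\<lambda>s'. s' ''y'' 0 = Num (fact n * a))"
  proof (rule runs_FOR[where J = "\<lambda>k (s' :: 'c state). s' ''y'' 0 = Num (fact k * a)"])
    fix k and s' :: "'c state" assume "k < n" "s' ''k'' 0 = Num k" "s' ''y'' 0 = Num (fact k * a)"
    then show "runs (times_com ''k'') s' (4 * (n + 1))
        (\<lambda>s''. upd s'' ''k'' 0 (Num (Suc k)) ''y'' 0 = Num (fact (Suc k) * a))"
      by (intro runs_conseq[OF runs_times_com]) (auto simp: algebra_simps)
  qed (use assms in \<open>auto simp: agree_off_def\<close>)
  then have fact: "runs (FOR ''k'' (var ''n'') (times_com ''k'')) ?s (6 * npow n 2)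
      (\<lambda>s'. s' ''y'' 0 = Num (fact n * a))"
    by (rule runs_loop_time[where K = 4 and k = 1 and c = 1 and n = n]) simp_all
  have "runs (Seq (FOR ''k'' (var ''n'') (times_com ''k''))
       (Seq (times_com ''j'') (set_var ''x'' (Plus (var ''x'') (var ''y''))))) ?s
       (6 * npow n 2 + (4 * (n + 1) + 1)) (\<lambda>s'. s' ''x'' 0 = Num (a * factor n j))"
  proof (rule runs_Seq_frame[OF fact])
    fix s' assume s': "agree_off (writes (FOR ''k'' (var ''n'') (times_com ''k''))) ?s s'"
      "s' ''y'' 0 = Num (fact n * a)"
    have j: "s' ''j'' 0 = Num j" and x: "s' ''x'' 0 = Num a"
      using agree_offD[OF s'(1)] assms by auto
    have "runs (times_com ''j'') s' (4 * (n + 1)) (\<lambda>s''. s'' ''y'' 0 = Num ((j + 1) * (fact n * a)))"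
      using assms(4) by (intro runs_conseq[OF runs_times_com[of s' "fact n * a" "''j''" j, OF s'(2) j]]) auto
    then show "runs (Seq (times_com ''j'') (set_var ''x'' (Plus (var ''x'') (var ''y'')))) s'
        (4 * (n + 1) + 1) (\<lambda>s''. s'' ''x'' 0 = Num (a * factor n j))"
    proof (rule runs_Seq_frame)
      fix s'' :: "'c state"
      assume ag: "agree_off (writes (times_com ''j'')) s' s''"
        and y: "s'' ''y'' 0 = Num ((j + 1) * (fact n * a))"
      have "s'' ''x'' 0 = Num a" using agree_offD[OF ag] x by simp
      moreover have "a + (j + 1) * (fact n * a) = a * factor n j"
        by (simp add: factor_def algebra_simps)
      ultimately show "runs (set_var ''x'' (Plus (var ''x'') (var ''y''))) s'' 1
          (\<lambda>s''. s'' ''x'' 0 = Num (a * factor n j))"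
        using y by (intro runs_Assign) simp_all
    qed
  qed
  then have "runs multiply_com s (1 + (6 * npow n 2 + (4 * (n + 1) + 1)))
      (\<lambda>s'. s' ''x'' 0 = Num (a * factor n j))"
    unfolding multiply_com_def using assms(3) by (intro runs_Assign_Seq) simp
  then show ?thesis by (rule runs_mono) (use npow_ge_n[of 2 n] in simp)
qed

definition product_com :: "cond list \<Rightarrow> com" where
  "product_com bs = Seq (set_var ''x'' (NumLit 1)) (FOR ''j'' (var ''n'') (guarded bs multiply_com))"

lemma writes_product_com [simp]: "writes (product_com bs) = {''j'', ''k'', ''l'', ''x'', ''y'', ''z''}"
  by (auto simp: product_com_def)

text \<open>The guards are evaluated in the course of the loop, so the hypothesis on them concerns
  every state that differs from \<open>s\<close> only in the scratch arrays.\<close>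

lemma runs_product_com:
  fixes s :: "'c state"
  assumes n: "s ''n'' 0 = Num n" and len: "length bs \<le> 2"
    and bs: "\<And>j s'. j < n \<Longrightarrow> agree_off {''j'', ''k'', ''l'', ''x'', ''y'', ''z''} s s' \<Longrightarrow> s' ''j'' 0 = Num j
      \<Longrightarrow> (\<forall>b\<in>set bs. holds b s') \<longleftrightarrow> G j"
  shows "runs (product_com bs) s (18 * npow n 3) (\<lambda>s'. s' ''x'' 0 = Num (factor_prod n G))"
proof -
  let ?s = "upd s ''x'' 0 (Num 1)"
  let ?p = "\<lambda>j. \<Prod>i<j. if G i then factor n i else 1"
  have "runs (FOR ''j'' (var ''n'') (guarded bs multiply_com)) ?s (n * (14 * npow n 2 + 2) + 2)
      (\<lambda>s'. s' ''x'' 0 = Num (?p n))"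
  proof (rule runs_FOR[where J = "\<lambda>j (s' :: 'c state). s' ''x'' 0 = Num (?p j)"])
    fix j and s' :: "'c state" assume j: "j < n" "s' ''j'' 0 = Num j" "s' ''x'' 0 = Num (?p j)"
      and ag: "agree_off (insert ''j'' (writes (guarded bs multiply_com))) ?s s'"
    have "agree_off {''j'', ''k'', ''l'', ''x'', ''y'', ''z''} s s'"
      using ag by (auto simp: agree_off_def)
    from bs[OF j(1) this j(2)] have G: "(\<forall>b\<in>set bs. holds b s') \<longleftrightarrow> G j" .
    have n': "s' ''n'' 0 = Num n" using agree_offD[OF ag, of "''n''"] n by simp
    have "runs (guarded bs multiply_com) s' (length bs + 12 * npow n 2) (\<lambda>s''. s'' ''x'' 0 = Num (?p (Suc j)))"
    proof (rule runs_guarded)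
      assume "\<forall>b\<in>set bs. holds b s'"
      with G show "runs multiply_com s' (12 * npow n 2) (\<lambda>s''. s'' ''x'' 0 = Num (?p (Suc j)))"
        using runs_multiply_com[of s' n j, OF n' j(2,3,1)] by simp
    next
      assume "\<not> (\<forall>b\<in>set bs. holds b s')"
      with G show "s' ''x'' 0 = Num (?p (Suc j))" using j(3) by simp
    qed
    then show "runs (guarded bs multiply_com) s' (14 * npow n 2)
        (\<lambda>s''. upd s'' ''j'' 0 (Num (Suc j)) ''x'' 0 = Num (?p (Suc j)))"
    proof (rule runs_conseq)
      show "length bs + 12 * npow n 2 \<le> 14 * npow n 2"
      using len npow_ge_1[of n 2] by linarith
    qed simp
  qed (use n in \<open>auto simp: agree_off_def\<close>)
  then have "runs (FOR ''j'' (var ''n'') (guarded bs multiply_com)) ?s (16 * npow n 3)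
      (\<lambda>s'. s' ''x'' 0 = Num (?p n))"
    by (rule runs_loop_time[where K = 14 and k = 2 and c = 1 and n = n]) simp_all
  then have "runs (product_com bs) s (1 + 16 * npow n 3) (\<lambda>s'. s' ''x'' 0 = Num (factor_prod n G))"
    unfolding product_com_def factor_prod_def by (intro runs_Assign_Seq) simp
  then show ?thesis by (rule runs_mono) (use npow_ge_1[of n 3] in simp)
qed

section \<open>Raising the flag for a contradiction\<close>

definition flag_com :: "cond list \<Rightarrow> com" where
  "flag_com bs = FOR ''j'' (var ''n'') (guarded bs (set_var ''contradictory'' (NumLit 1)))"

lemma writes_flag_com [simp]: "writes (flag_com bs) = {''j'', ''contradictory''}"
  by (auto simp: flag_com_def)

text \<open>The flag is never lowered, so consecutive searches accumulate the disjunction of their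
  outcomes, with \<open>B\<close> as the outcome so far.\<close>

lemma runs_flag_com:
  fixes s :: "'c state"
  assumes n: "s ''n'' 0 = Num n" and len: "length bs \<le> 3"
    and flag: "s ''contradictory'' 0 = Num (of_bool B)"
    and bs: "\<And>j s'. j < n \<Longrightarrow> agree_off {''j'', ''contradictory''} s s' \<Longrightarrow> s' ''j'' 0 = Num j
      \<Longrightarrow> (\<forall>b\<in>set bs. holds b s') \<longleftrightarrow> G j"
  shows "runs (flag_com bs) s (6 * (n + 1))
    (\<lambda>s'. s' ''contradictory'' 0 = Num (of_bool (B \<or> (\<exists>j<n. G j))))"
proof -
  let ?J = "\<lambda>j (s' :: 'c state). s' ''contradictory'' 0 = Num (of_bool (B \<or> (\<exists>i<j. G i)))"
  have "runs (flag_com bs) s (n * (4 + 2) + 2) (?J n)"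
    unfolding flag_com_def
  proof (rule runs_FOR[where J = ?J])
    fix j and s' :: "'c state" assume j: "j < n" "s' ''j'' 0 = Num j" "?J j s'"
      and ag: "agree_off (insert ''j'' (writes (guarded bs (set_var ''contradictory'' (NumLit 1))))) s s'"
    have "agree_off {''j'', ''contradictory''} s s'"
      using ag by (auto simp: agree_off_def)
    from bs[OF j(1) this j(2)] have G: "(\<forall>b\<in>set bs. holds b s') \<longleftrightarrow> G j" .
    have "runs (guarded bs (set_var ''contradictory'' (NumLit 1))) s' (length bs + 1) (?J (Suc j))"
    proof (rule runs_guarded)
      assume "\<forall>b\<in>set bs. holds b s'"
      then have "B \<or> (\<exists>i<Suc j. G i)" using G by blast
      then show "runs (set_var ''contradictory'' (NumLit 1)) s' 1 (?J (Suc j))"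
        by (intro runs_Assign) simp_all
    next
      assume "\<not> (\<forall>b\<in>set bs. holds b s')"
      then have "(\<exists>i<Suc j. G i) \<longleftrightarrow> (\<exists>i<j. G i)" using G less_Suc_eq by metis
      then show "?J (Suc j) s'" using j(3) by simp
    qed
    then show "runs (guarded bs (set_var ''contradictory'' (NumLit 1))) s' 4
        (\<lambda>s''. ?J (Suc j) (upd s'' ''j'' 0 (Num (Suc j))))"
      by (rule runs_conseq) (use len in simp_all)
  qed (use n flag in \<open>auto simp: agree_off_def\<close>)
  then show ?thesis by (rule runs_mono) simp
qed

text \<open>The positions of constants in the input are numbered so that the first constant of the
  \<open>i\<close>-th sentence is node \<open>i\<close> and the second one is node \<open>n + i\<close>; a constant may have several
  nodes.\<close>

definition node :: "'c sentence list \<Rightarrow> nat \<Rightarrow> 'c" where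
  "node xs v = (map (fst \<circ> snd) xs @ map (snd \<circ> snd) xs) ! v"

lemma node_first: "i < length xs \<Longrightarrow> node xs i = fst (snd (xs ! i))"
  by (simp add: node_def nth_append)

lemma node_second: "i < length xs \<Longrightarrow> node xs (length xs + i) = snd (snd (xs ! i))"
  by (simp add: node_def nth_append)

lemma node_image: "node xs ` {..<2 * length xs} = consts_of xs"
proof -
  have "node xs ` {..<2 * length xs} = set (map (fst \<circ> snd) xs @ map (snd \<circ> snd) xs)"
    unfolding node_def set_conv_nth by (auto simp: mult_2)
  then show ?thesis by (auto simp: consts_of_def)
qed

section \<open>Sets of constants as marks on nodes\<close>

definition loaded :: "'c sentence list \<Rightarrow> 'c state \<Rightarrow> bool" where
  "loaded xs s \<longleftrightarrow> s ''n'' 0 = Num (length xs) \<and> s ''rows'' 0 = Num (2 * length xs) \<and>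
     (\<forall>i<length xs. s ''symbol'' i = Sym (fst (xs ! i))) \<and>
     (\<forall>v<2 * length xs. s ''constant'' v = Con (node xs v))"

definition marks :: "'c sentence list \<Rightarrow> 'c set \<Rightarrow> 'c state \<Rightarrow> bool" where
  "marks xs S s \<longleftrightarrow> (\<forall>v<2 * length xs. s ''reach'' v = Num (of_bool (node xs v \<in> S)))"

text \<open>The commands that follow the loading phase write to none of these four arrays. The
  arrays \<open>first\<close> and \<open>second\<close> are read only while loading and so are not
  among them.\<close>

lemma loaded_agree:
  "agree_off X s s' \<Longrightarrow> X \<inter> {''n'', ''rows'', ''symbol'', ''constant''} = {} \<Longrightarrow> loaded xs s \<Longrightarrow> loaded xs s'"
  by (auto simp: agree_off_def loaded_def)

lemma marks_agree: "agree_off X s s' \<Longrightarrow> ''reach'' \<notin> X \<Longrightarrow> marks xs S s \<Longrightarrow> marks xs S s'"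
  by (simp add: agree_off_def marks_def)

lemma loaded_num: "loaded xs s \<Longrightarrow> s ''n'' 0 = Num (length xs)" "loaded xs s \<Longrightarrow> s ''rows'' 0 = Num (2 * length xs)"
  by (simp_all add: loaded_def)

text \<open>Constants are opaque and may occupy several nodes, so adding one constant to the marked
  set takes a scan of all nodes with an equality test.\<close>

definition mark_com :: "aexp \<Rightarrow> com" where
  "mark_com e = FOR ''v'' (var ''rows'')
     (guarded [Eq (Cell ''constant'' (var ''v'')) e] (Assign ''reach'' (var ''v'') (NumLit 1)))"

lemma writes_mark_com [simp]: "writes (mark_com e) = {''v'', ''reach''}"
  by (auto simp: mark_com_def)

lemma runs_mark_com:
  fixes s :: "'c state"
  assumes loaded: "loaded xs s" and marks: "marks xs S s"
    and e: "\<And>s'. agree_off {''v'', ''reach''} s s' \<Longrightarrow> aval e s' = Con c"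
  shows "runs (mark_com e) s (8 * (length xs + 1)) (marks xs (insert c S))"
proof -
  let ?J = "\<lambda>k s'. \<forall>v<2 * length xs. s' ''reach'' v =
    Num (of_bool (node xs v \<in> (if v < k then insert c S else S)))"
  let ?c = "guarded [Eq (Cell ''constant'' (var ''v'')) e] (Assign ''reach'' (var ''v'') (NumLit 1))"
  have "runs (mark_com e) s (2 * length xs * (2 + 2) + 2) (?J (2 * length xs))"
    unfolding mark_com_def
  proof (rule runs_FOR[where J = ?J])
    fix s' :: "'c state" assume ag: "agree_off (insert ''v'' (writes ?c)) s s'"
    have "loaded xs s'" by (rule loaded_agree[OF ag _ loaded]) simp
    then show "num (aval (var ''rows'') s') = 2 * length xs" by (simp add: loaded_def)
  next
    fix k and s' :: "'c state"
    assume k: "k < 2 * length xs" "s' ''v'' 0 = Num k" "?J k s'"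
      and ag: "agree_off (insert ''v'' (writes ?c)) s s'"
    have ld: "loaded xs s'" by (rule loaded_agree[OF ag _ loaded]) simp
    have "aval e s' = Con c" using e ag by simp
    then have test: "(\<forall>b\<in>set [Eq (Cell ''constant'' (var ''v'')) e]. holds b s') \<longleftrightarrow> node xs k = c"
      using ld k(1,2) by (simp add: loaded_def)
    have "runs ?c s' (length [Eq (Cell ''constant'' (var ''v'')) e] + 1)
        (\<lambda>s''. ?J (Suc k) (upd s'' ''v'' 0 (Num (Suc k))))"
    proof (rule runs_guarded, goal_cases)
      case 1
      then show ?case using k test by (intro runs_Assign) (auto simp: less_Suc_eq)
    next
      case 2
      then show ?case using k test by (auto simp: less_Suc_eq)
    qed
    then show "runs ?c s' 2 (\<lambda>s''. ?J (Suc k) (upd s'' ''v'' 0 (Num (Suc k))))"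
      by (rule runs_conseq) auto
  qed (use marks in \<open>auto simp: marks_def\<close>)
  then show ?thesis by (rule runs_conseq) (auto simp: marks_def)
qed

section \<open>Reachability by repeated rounds over the sentences\<close>

fun propagate :: "'c sentence \<Rightarrow> 'c set \<Rightarrow> 'c set" where
  "propagate (Y, a, b) S = (if Y = YA \<and> a \<in> S then insert b S else S)"

abbreviation round_of :: "'c sentence list \<Rightarrow> 'c set \<Rightarrow> 'c set" where
  "round_of xs \<equiv> fold propagate xs"

lemma fold_propagate_mono: "S \<subseteq> fold propagate xs S"
proof (induction xs arbitrary: S)
  case (Cons x xs)
  have "S \<subseteq> propagate x S" by (cases x) auto
  then show ?case using Cons[of "propagate x S"] by simp
qed simp

lemma fold_propagate_arrow:
  assumes "(YA, a, b) \<in> set xs" "a \<in> S"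
  shows "b \<in> fold propagate xs S"
  using assms
proof (induction xs arbitrary: S)
  case (Cons x xs)
  show ?case
  proof (cases "x = (YA, a, b)")
    case True
    then show ?thesis using Cons.prems fold_propagate_mono[of "insert b S" xs] by auto
  next
    case False
    moreover have "a \<in> propagate x S" using Cons.prems by (cases x) auto
    ultimately show ?thesis using Cons by simp
  qed
qed simp

text \<open>The list \<open>ys\<close> is kept apart from \<open>xs\<close> so that the closure
  hypothesis on \<open>U\<close> stays fixed while the induction shortens \<open>ys\<close>.\<close>

lemma fold_propagate_closed:
  assumes "set ys \<subseteq> set xs" "arrows xs `` U \<subseteq> U" "S \<subseteq> U"
  shows "fold propagate ys S \<subseteq> U"
  using assms(1,3)
proof (induction ys arbitrary: S)
  case (Cons y ys)
  obtain Y a b where y: "y = (Y, a, b)" by (cases y)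
  have "propagate y S \<subseteq> U"
    using Cons.prems assms(2) unfolding y by (auto simp: arrows_def)
  then show ?case using Cons by simp
qed simp

text \<open>A round follows every arrow at least once, so \<open>k\<close> rounds cover all paths of
  length \<open>k\<close>; marks set early in a round may already be used later in it, but never
  leave the up-set. Reachable constants are reached by paths no longer than the number of arrows, so
  \<open>length xs\<close> rounds suffice.\<close>

lemma rounds_eq_upset: "(round_of xs ^^ length xs) P = upset xs P"
proof
  have closed: "arrows xs `` upset xs P \<subseteq> upset xs P"
    by (auto simp: upset_def intro: rtrancl_into_rtrancl)
  have "(round_of xs ^^ k) P \<subseteq> upset xs P" for k
  proof (induction k)
    case (Suc k)
    then show ?case
      using fold_propagate_closed[OF subset_refl closed] by simp
  qed (simp add: subset_upset)
  then show "(round_of xs ^^ length xs) P \<subseteq> upset xs P" .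
  have mono: "(round_of xs ^^ k) P \<subseteq> (round_of xs ^^ (k + m)) P" for k m
  proof (induction m)
    case (Suc m)
    then show ?case using fold_propagate_mono by fastforce
  qed simp
  have steps: "b \<in> (round_of xs ^^ k) P" if "(a, b) \<in> arrows xs ^^ k" "a \<in> P" for a b k
    using that
  proof (induction k arbitrary: b)
    case (Suc k)
    then obtain c where "c \<in> (round_of xs ^^ k) P" "(c, b) \<in> arrows xs" by auto
    then show ?case using fold_propagate_arrow[of c b xs "(round_of xs ^^ k) P"]
      by (simp add: arrows_def)
  qed simp
  have arr: "arrows xs \<subseteq> snd ` set xs" by (force simp: arrows_def)
  then have fin: "finite (arrows xs)" by (rule finite_subset) simp
  have card: "card (arrows xs) \<le> length xs"
    using card_mono[OF _ arr] card_image_le[of "set xs" snd] card_length[of xs] by simp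
  show "upset xs P \<subseteq> (round_of xs ^^ length xs) P"
  proof
    fix b assume "b \<in> upset xs P"
    then obtain a where "a \<in> P" "(a, b) \<in> (arrows xs)\<^sup>*" by (auto simp: upset_def)
    \<comment> \<open>In a finite relation, paths of length at most its cardinality already give the
      reflexive transitive closure.\<close>
    then obtain k where "k \<le> card (arrows xs)" "(a, b) \<in> arrows xs ^^ k"
      unfolding rtrancl_finite_eq_relpow[OF fin] by auto
    then show "b \<in> (round_of xs ^^ length xs) P"
      using steps[OF _ \<open>a \<in> P\<close>] mono[of k "length xs - k"] card by auto
  qed
qed

definition round_com :: com where
  "round_com = FOR ''i'' (var ''n'')
     (guarded [Eq (Cell ''symbol'' (var ''i'')) (SymLit YA), Eq (Cell ''reach'' (var ''i'')) (NumLit 1)]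
       (mark_com (Cell ''constant'' (Plus (var ''n'') (var ''i'')))))"

lemma writes_round_com [simp]: "writes round_com = {''i'', ''v'', ''reach''}"
  by (auto simp: round_com_def)

text \<open>After \<open>k\<close> sentences the marked set is the fold over the first
  \<open>k\<close> of them. Node \<open>k\<close> is the source of the \<open>k\<close>-th arrow,
  and node \<open>n + k\<close> its target.\<close>

lemma runs_round_com:
  fixes s :: "'c state"
  assumes loaded: "loaded xs s" and marks: "marks xs S s"
  shows "runs round_com s (12 * npow (length xs) 2) (marks xs (round_of xs S))"
proof -
  let ?n = "length xs"
  let ?J = "\<lambda>k. marks xs (fold propagate (take k xs) S)"
  let ?bs = "[Eq (Cell ''symbol'' (var ''i'')) (SymLit YA), Eq (Cell ''reach'' (var ''i'')) (NumLit 1)]"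
  let ?m = "mark_com (Cell ''constant'' (Plus (var ''n'') (var ''i'')))"
  have "runs round_com s (?n * (10 * (?n + 1) + 2) + 2) (?J ?n)"
    unfolding round_com_def
  proof (rule runs_FOR[where J = ?J])
    fix s' :: "'c state" assume ag: "agree_off (insert ''i'' (writes (guarded ?bs ?m))) s s'"
    have "loaded xs s'" by (rule loaded_agree[OF ag _ loaded]) simp
    then show "num (aval (var ''n'') s') = ?n" by (simp add: loaded_def)
  next
    fix k and s' :: "'c state"
    assume k: "k < ?n" "s' ''i'' 0 = Num k" "?J k s'"
      and ag: "agree_off (insert ''i'' (writes (guarded ?bs ?m))) s s'"
    have ld: "loaded xs s'" by (rule loaded_agree[OF ag _ loaded]) simp
    let ?S = "fold propagate (take k xs) S"
    obtain Y a b where x: "xs ! k = (Y, a, b)" by (cases "xs ! k")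
    have nodes: "node xs k = a" "node xs (?n + k) = b"
      using node_first[OF k(1)] node_second[OF k(1)] x by auto
    have next_set: "fold propagate (take (Suc k) xs) S = (if Y = YA \<and> a \<in> ?S then insert b ?S else ?S)"
      using k(1) by (simp add: take_Suc_conv_app_nth x)
    have test: "(\<forall>b\<in>set ?bs. holds b s') \<longleftrightarrow> Y = YA \<and> a \<in> ?S"
      using ld k nodes x by (auto simp: loaded_def marks_def)
    have "runs (guarded ?bs ?m) s' (length ?bs + 8 * (?n + 1)) (?J (Suc k))"
    proof (rule runs_guarded)
      assume "\<forall>b\<in>set ?bs. holds b s'"
      then have "fold propagate (take (Suc k) xs) S = insert b ?S"
        using test next_set by simp
      moreover have "aval (Cell ''constant'' (Plus (var ''n'') (var ''i''))) s'' = Con b"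
        if "agree_off {''v'', ''reach''} s' s''" for s'' :: "'c state"
        using agree_offD[OF that, of "''constant''"] agree_offD[OF that, of "''n''"]
          agree_offD[OF that, of "''i''"] ld k(1,2) nodes by (simp add: loaded_def)
      ultimately show "runs ?m s' (8 * (?n + 1)) (?J (Suc k))"
        using runs_mark_com[OF ld k(3)] by simp
    next
      assume "\<not> (\<forall>b\<in>set ?bs. holds b s')"
      then have "fold propagate (take (Suc k) xs) S = ?S" using test next_set by metis
      then show "?J (Suc k) s'" using k(3) by simp
    qed
    then show "runs (guarded ?bs ?m) s' (10 * (?n + 1))
        (\<lambda>s''. ?J (Suc k) (upd s'' ''i'' 0 (Num (Suc k))))"
      by (rule runs_conseq) (auto simp: marks_def)
  qed (use marks in \<open>auto simp: marks_def\<close>)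
  then have "runs round_com s (12 * npow ?n 2) (?J ?n)"
    by (rule runs_loop_time[where K = 10 and k = 1 and c = 1 and n = ?n]) simp_all
  then show ?thesis by simp
qed

text \<open>Two seeds are needed for the clash test of \<open>Ipq\<close>; for the up-set of a single constant
  \<open>p = q\<close>.\<close>

definition close_com :: com where
  "close_com = Seq (FOR ''v'' (var ''rows'') (Assign ''reach'' (var ''v'') (NumLit 0)))
     (Seq (mark_com (var ''p'')) (Seq (mark_com (var ''q'')) (FOR ''k'' (var ''n'') round_com)))"

lemma writes_close_com [simp]: "writes close_com = {''i'', ''k'', ''v'', ''reach''}"
  by (auto simp: close_com_def)

lemma runs_close_com:
  fixes s :: "'c state"
  assumes loaded: "loaded xs s" and pq: "s ''p'' 0 = Con a" "s ''q'' 0 = Con b"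
  shows "runs close_com s (36 * npow (length xs) 3) (marks xs (upset xs {a, b}))"
proof -
  let ?n = "length xs"
  have clear: "runs (FOR ''v'' (var ''rows'') (Assign ''reach'' (var ''v'') (NumLit 0))) s
      (2 * ?n * (1 + 2) + 2) (\<lambda>s'. \<forall>v<2 * ?n. s' ''reach'' v = Num 0)"
  proof (rule runs_FOR[where J = "\<lambda>k (s' :: 'c state). \<forall>v<k. s' ''reach'' v = Num 0"])
    fix s' :: "'c state"
    assume ag: "agree_off (insert ''v'' (writes (Assign ''reach'' (var ''v'') (NumLit 0)))) s s'"
    have "loaded xs s'" by (rule loaded_agree[OF ag _ loaded]) simp
    then show "num (aval (var ''rows'') s') = 2 * ?n" by (simp add: loaded_def)
  next
    fix k and s' :: "'c state"
    assume "s' ''v'' 0 = Num k" "\<forall>v<k. s' ''reach'' v = Num 0"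
    then show "runs (Assign ''reach'' (var ''v'') (NumLit 0)) s' 1
        (\<lambda>s''. \<forall>v<Suc k. upd s'' ''v'' 0 (Num (Suc k)) ''reach'' v = Num 0)"
      by (intro runs_Assign) (auto simp: less_Suc_eq)
  qed simp_all
  have rounds: "runs (FOR ''k'' (var ''n'') round_com) s' (14 * npow ?n 3)
      (marks xs (upset xs P))" if ld: "loaded xs s'" and mk: "marks xs P s'" for P and s' :: "'c state"
    unfolding rounds_eq_upset[symmetric]
  proof (rule runs_loop_time[where K = 12 and k = 2 and c = 1 and n = ?n], rule runs_FOR[where J = "\<lambda>k. marks xs ((round_of xs ^^ k) P)"])
    fix s'' :: "'c state" assume ag: "agree_off (insert ''k'' (writes round_com)) s' s''"
    have ld': "loaded xs s''" by (rule loaded_agree[OF ag _ ld]) simp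
    then show "num (aval (var ''n'') s'') = ?n" by (simp add: loaded_def)
    fix k assume "marks xs ((round_of xs ^^ k) P) s''"
    from runs_round_com[OF ld' this]
    show "runs round_com s'' (12 * npow ?n 2)
        (\<lambda>s''. marks xs ((round_of xs ^^ Suc k) P) (upd s'' ''k'' 0 (Num (Suc k))))"
      by (rule runs_conseq) (auto simp: marks_def)
  qed (use mk in \<open>auto simp: marks_def\<close>)
  have "runs close_com s ((2 * ?n * (1 + 2) + 2) + (8 * (?n + 1) + (8 * (?n + 1) +
      14 * npow ?n 3))) (marks xs (upset xs {a, b}))"
    unfolding close_com_def
  proof (rule runs_Seq_frame[OF clear])
    fix s1 :: "'c state"
    assume ag: "agree_off (writes (FOR ''v'' (var ''rows'') (Assign ''reach'' (var ''v'') (NumLit 0)))) s s1"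
      and zero: "\<forall>v<2 * ?n. s1 ''reach'' v = Num 0"
    have ld1: "loaded xs s1" by (rule loaded_agree[OF ag _ loaded]) simp
    have mk1: "marks xs {} s1" using zero by (simp add: marks_def)
    have pq1: "s1 ''p'' 0 = Con a" "s1 ''q'' 0 = Con b" using agree_offD[OF ag] pq by auto
    have "runs (mark_com (var ''p'')) s1 (8 * (?n + 1)) (marks xs {a})"
      by (rule runs_mark_com[OF ld1 mk1]) (use pq1 in \<open>simp add: agree_off_def\<close>)
    then show "runs (Seq (mark_com (var ''p'')) (Seq (mark_com (var ''q'')) (FOR ''k'' (var ''n'') round_com))) s1
        (8 * (?n + 1) + (8 * (?n + 1) + 14 * npow ?n 3)) (marks xs (upset xs {a, b}))"
    proof (rule runs_Seq_frame)
      fix s2 :: "'c state" assume ag: "agree_off (writes (mark_com (var ''p''))) s1 s2" and mk2: "marks xs {a} s2"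
      have ld2: "loaded xs s2" by (rule loaded_agree[OF ag _ ld1]) simp
      have q2: "s2 ''q'' 0 = Con b" using agree_offD[OF ag] pq1 by auto
      have "runs (mark_com (var ''q'')) s2 (8 * (?n + 1)) (marks xs {b, a})"
        by (rule runs_mark_com[OF ld2 mk2]) (use q2 in \<open>simp add: agree_off_def\<close>)
      then show "runs (Seq (mark_com (var ''q'')) (FOR ''k'' (var ''n'') round_com)) s2
          (8 * (?n + 1) + 14 * npow ?n 3) (marks xs (upset xs {a, b}))"
      proof (rule runs_Seq_frame)
        fix s3 :: "'c state" assume ag: "agree_off (writes (mark_com (var ''q''))) s2 s3" and mk3: "marks xs {b, a} s3"
        have ld3: "loaded xs s3" by (rule loaded_agree[OF ag _ ld2]) simp
        show "runs (FOR ''k'' (var ''n'') round_com) s3 (14 * npow ?n 3) (marks xs (upset xs {a, b}))"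
          using rounds[OF ld3 mk3] by (simp add: insert_commute)
      qed
    qed
  qed
  then show ?thesis using npow_ge_n[of 3 ?n] by (elim runs_mono) simp
qed

section \<open>Tests of the criterion on a marked up-set\<close>

abbreviation symbol_is :: "symb \<Rightarrow> cond" where
  "symbol_is Y \<equiv> Eq (Cell ''symbol'' (var ''j'')) (SymLit Y)"

abbreviation first_marked :: cond where
  "first_marked \<equiv> Eq (Cell ''reach'' (var ''j'')) (NumLit 1)"

abbreviation second_marked :: cond where
  "second_marked \<equiv> Eq (Cell ''reach'' (Plus (var ''n'') (var ''j''))) (NumLit 1)"

lemma holds_tests:
  assumes "loaded xs s" "s ''j'' 0 = Num j" "j < length xs"
  shows "holds (symbol_is Y) s \<longleftrightarrow> fst (xs ! j) = Y"
    and "marks xs S s \<Longrightarrow> holds first_marked s \<longleftrightarrow> fst (snd (xs ! j)) \<in> S"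
    and "marks xs S s \<Longrightarrow> holds second_marked s \<longleftrightarrow> snd (snd (xs ! j)) \<in> S"
  using assms by (simp_all add: loaded_def marks_def node_first node_second)

definition clash_com :: com where
  "clash_com = flag_com [symbol_is YE, first_marked, second_marked]"

lemma writes_clash_com [simp]: "writes clash_com = {''j'', ''contradictory''}"
  by (simp add: clash_com_def)

lemma ex_entry_nth:
  "(\<exists>c d. (Y, c, d) \<in> set xs \<and> R c d) \<longleftrightarrow>
   (\<exists>j<length xs. fst (xs ! j) = Y \<and> R (fst (snd (xs ! j))) (snd (snd (xs ! j))))" (is "?A \<longleftrightarrow> ?B")
proof
  assume ?A
  then show ?B by (auto simp: in_set_conv_nth)
next
  assume ?B
  then obtain j where "j < length xs" "fst (xs ! j) = Y" "R (fst (snd (xs ! j))) (snd (snd (xs ! j)))"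
    by blast
  then show ?A using nth_mem[of j xs] by (metis prod.collapse)
qed

lemma clash_nth:
  "clash xs P \<longleftrightarrow> (\<exists>j<length xs. fst (xs ! j) = YE \<and> fst (snd (xs ! j)) \<in> upset xs P \<and>
     snd (snd (xs ! j)) \<in> upset xs P)"
  unfolding clash_def by (rule ex_entry_nth)

lemma runs_clash_com:
  fixes s :: "'c state"
  assumes ld: "loaded xs s" and mk: "marks xs (upset xs P) s"
    and flag: "s ''contradictory'' 0 = Num (of_bool B)"
  shows "runs clash_com s (6 * (length xs + 1))
    (\<lambda>s'. s' ''contradictory'' 0 = Num (of_bool (B \<or> clash xs P)))"
  unfolding clash_com_def clash_nth
proof (rule runs_flag_com[of s "length xs" _ B, OF loaded_num(1)[OF ld] _ flag])
  fix j and s' :: "'c state"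
  assume j: "j < length xs" "s' ''j'' 0 = Num j" and ag: "agree_off {''j'', ''contradictory''} s s'"
  have "loaded xs s'" by (rule loaded_agree[OF ag _ ld]) simp
  note tests = holds_tests[OF this j(2,1)]
  have "marks xs (upset xs P) s'" by (rule marks_agree[OF ag _ mk]) simp
  from tests(1) tests(2,3)[OF this]
  show "(\<forall>b\<in>set [symbol_is YE, first_marked, second_marked]. holds b s') \<longleftrightarrow>
      fst (xs ! j) = YE \<and> fst (snd (xs ! j)) \<in> upset xs P \<and> snd (snd (xs ! j)) \<in> upset xs P"
    by (simp del: holds.simps)
qed simp

definition inspect_com :: com where
  "inspect_com = Seq close_com clash_com"

lemma writes_inspect_com [simp]: "writes inspect_com = {''i'', ''k'', ''v'', ''reach'', ''j'', ''contradictory''}"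
  by (auto simp: inspect_com_def)

text \<open>The postcondition keeps the marks, because the test of O-sentences and the computation
  of the values use the same up-set again.\<close>

lemma runs_inspect_com:
  fixes s :: "'c state"
  assumes ld: "loaded xs s" and pq: "s ''p'' 0 = Con a" "s ''q'' 0 = Con b"
    and flag: "s ''contradictory'' 0 = Num (of_bool B)"
  shows "runs inspect_com s (42 * npow (length xs) 3) (\<lambda>s'. marks xs (upset xs {a, b}) s' \<and>
    s' ''contradictory'' 0 = Num (of_bool (B \<or> clash xs {a, b})))"
proof -
  let ?n = "length xs"
  have "runs inspect_com s (36 * npow ?n 3 + 6 * (?n + 1)) (\<lambda>s'. marks xs (upset xs {a, b}) s' \<and>
    s' ''contradictory'' 0 = Num (of_bool (B \<or> clash xs {a, b})))"
    unfolding inspect_com_def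
  proof (rule runs_Seq_frame[OF runs_close_com[OF ld pq]])
    fix s1 :: "'c state"
    assume ag: "agree_off (writes close_com) s s1" and mk: "marks xs (upset xs {a, b}) s1"
    have ld1: "loaded xs s1" by (rule loaded_agree[OF ag _ ld]) simp
    have "s1 ''contradictory'' 0 = Num (of_bool B)" using agree_offD[OF ag] flag by simp
    from runs_clash_com[OF ld1 mk this]
    show "runs clash_com s1 (6 * (?n + 1)) (\<lambda>s'. marks xs (upset xs {a, b}) s' \<and>
        s' ''contradictory'' 0 = Num (of_bool (B \<or> clash xs {a, b})))"
    proof (rule runs_conseq)
      fix s2 :: "'c state"
      assume ag: "agree_off (writes clash_com) s1 s2"
        and c: "s2 ''contradictory'' 0 = Num (of_bool (B \<or> clash xs {a, b}))"
      have "marks xs (upset xs {a, b}) s2" by (rule marks_agree[OF ag _ mk]) simp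
      with c show "marks xs (upset xs {a, b}) s2 \<and>
        s2 ''contradictory'' 0 = Num (of_bool (B \<or> clash xs {a, b}))" by blast
    qed simp
  qed
  then show ?thesis by (rule runs_mono) (use npow_ge_n[of 3 ?n] in simp)
qed

definition negation_com :: com where
  "negation_com = flag_com [symbol_is YO, Eq (Cell ''constant'' (var ''j'')) (var ''p''), second_marked]"

lemma writes_negation_com [simp]: "writes negation_com = {''j'', ''contradictory''}"
  by (simp add: negation_com_def)

text \<open>The condition on O-sentences is split according to the first constant, so that it can be
  tested while the up-set of that constant is marked.\<close>

definition refuted :: "'c sentence list \<Rightarrow> 'c \<Rightarrow> bool" where
  "refuted xs c \<longleftrightarrow> (\<exists>d. (YO, c, d) \<in> set xs \<and> d \<in> upset xs {c})"

lemma refuted_nth: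
  "refuted xs c \<longleftrightarrow> (\<exists>j<length xs. fst (xs ! j) = YO \<and> fst (snd (xs ! j)) = c \<and>
     snd (snd (xs ! j)) \<in> upset xs {c})"
  unfolding refuted_def using ex_entry_nth[of YO xs "\<lambda>b d. b = c \<and> d \<in> upset xs {c}"] by simp

lemma runs_negation_com:
  fixes s :: "'c state"
  assumes ld: "loaded xs s" and mk: "marks xs (upset xs {c}) s" and p: "s ''p'' 0 = Con c"
    and flag: "s ''contradictory'' 0 = Num (of_bool B)"
  shows "runs negation_com s (6 * (length xs + 1))
    (\<lambda>s'. s' ''contradictory'' 0 = Num (of_bool (B \<or> refuted xs c)))"
  unfolding negation_com_def refuted_nth
proof (rule runs_flag_com[of s "length xs" _ B, OF loaded_num(1)[OF ld] _ flag])
  fix j and s' :: "'c state"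
  assume j: "j < length xs" "s' ''j'' 0 = Num j" and ag: "agree_off {''j'', ''contradictory''} s s'"
  have ld': "loaded xs s'" by (rule loaded_agree[OF ag _ ld]) simp
  note tests = holds_tests[OF this j(2,1)]
  have "marks xs (upset xs {c}) s'" by (rule marks_agree[OF ag _ mk]) simp
  note second = tests(3)[OF this]
  have "s' ''p'' 0 = Con c" using agree_offD[OF ag] p by simp
  then have "holds (Eq (Cell ''constant'' (var ''j'')) (var ''p'')) s' \<longleftrightarrow> fst (snd (xs ! j)) = c"
    using ld' j by (simp add: loaded_def node_first)
  then show "(\<forall>b\<in>set [symbol_is YO, Eq (Cell ''constant'' (var ''j'')) (var ''p''), second_marked]. holds b s') \<longleftrightarrow>
      fst (xs ! j) = YO \<and> fst (snd (xs ! j)) = c \<and> snd (snd (xs ! j)) \<in> upset xs {c}"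
    using tests(1) second by (simp del: holds.simps)
qed simp

section \<open>Computing the values of one constant, then of all\<close>

definition values_com :: com where
  "values_com = Seq (product_com [symbol_is YE, first_marked]) (Seq (Assign ''left'' (var ''u'') (var ''x''))
     (Seq (product_com [second_marked]) (Assign ''right'' (var ''u'') (var ''x''))))"

lemma writes_values_com [simp]:
  "writes values_com = {''j'', ''k'', ''l'', ''x'', ''y'', ''z'', ''left'', ''right''}"
  by (auto simp: values_com_def)

lemma runs_values_com:
  fixes s :: "'c state"
  assumes ld: "loaded xs s" and mk: "marks xs (upset xs {c}) s" and u: "s ''u'' 0 = Num u"
  shows "runs values_com s (38 * npow (length xs) 3) (\<lambda>s'.
    s' ''left'' = (s ''left'')(u := Num (left_val xs c)) \<and>
    s' ''right'' = (s ''right'')(u := Num (right_val xs c)))"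
proof -
  let ?n = "length xs"
  let ?S = "upset xs {c}"
  let ?L = "[symbol_is YE, first_marked]" and ?R = "[second_marked]"
  have tests: "((\<forall>b\<in>set ?L. holds b s') \<longleftrightarrow> first_in xs ?S j) \<and>
      ((\<forall>b\<in>set ?R. holds b s') \<longleftrightarrow> second_in xs ?S j)"
    if "loaded xs s'" "marks xs ?S s'" "s' ''j'' 0 = Num j" "j < ?n" for s' :: "'c state" and j
    using holds_tests(1)[OF that(1,3,4)] holds_tests(2,3)[OF that(1,3,4,2)]
    by (simp add: first_in_def second_in_def del: holds.simps)
  have prodL: "runs (product_com ?L) s (18 * npow ?n 3) (\<lambda>s'. s' ''x'' 0 = Num (left_val xs c))"
    unfolding left_val_def
  proof (rule runs_product_com[of s ?n, OF loaded_num(1)[OF ld]])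
    fix j and s' :: "'c state"
    assume j: "j < ?n" "s' ''j'' 0 = Num j" and ag: "agree_off {''j'', ''k'', ''l'', ''x'', ''y'', ''z''} s s'"
    have "loaded xs s'" by (rule loaded_agree[OF ag _ ld]) simp
    moreover have "marks xs ?S s'" by (rule marks_agree[OF ag _ mk]) simp
    ultimately show "(\<forall>b\<in>set ?L. holds b s') \<longleftrightarrow> first_in xs ?S j" using tests j by blast
  qed simp
  have "runs values_com s (18 * npow ?n 3 + (1 + (18 * npow ?n 3 + 1))) (\<lambda>s'.
    s' ''left'' = (s ''left'')(u := Num (left_val xs c)) \<and>
    s' ''right'' = (s ''right'')(u := Num (right_val xs c)))"
    unfolding values_com_def
  proof (rule runs_Seq_frame[OF prodL], rule runs_Assign_Seq)
    fix s1 :: "'c state"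
    assume ag: "agree_off (writes (product_com ?L)) s s1" and x: "s1 ''x'' 0 = Num (left_val xs c)"
    let ?s = "upd s1 ''left'' (num (aval (var ''u'') s1)) (aval (var ''x'') s1)"
    have "s1 ''u'' 0 = Num u" using agree_offD[OF ag] u by simp
    then have s2: "?s = upd s1 ''left'' u (Num (left_val xs c))" using x by simp
    have ag2: "agree_off {''j'', ''k'', ''l'', ''x'', ''y'', ''z'', ''left''} s ?s"
      unfolding s2 by (rule agree_off_upd[OF agree_off_mono[OF ag]]) auto
    have ld2: "loaded xs ?s" by (rule loaded_agree[OF ag2 _ ld]) simp
    have mk2: "marks xs ?S ?s" by (rule marks_agree[OF ag2 _ mk]) simp
    have "runs (product_com ?R) ?s (18 * npow ?n 3) (\<lambda>s'. s' ''x'' 0 = Num (right_val xs c))"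
      unfolding right_val_def
    proof (rule runs_product_com[of ?s ?n, OF loaded_num(1)[OF ld2]])
      fix j and s' :: "'c state"
      assume j: "j < ?n" "s' ''j'' 0 = Num j" and ag: "agree_off {''j'', ''k'', ''l'', ''x'', ''y'', ''z''} ?s s'"
      have "loaded xs s'" by (rule loaded_agree[OF ag _ ld2]) simp
      moreover have "marks xs ?S s'" by (rule marks_agree[OF ag _ mk2]) simp
      ultimately show "(\<forall>b\<in>set ?R. holds b s') \<longleftrightarrow> second_in xs ?S j" using tests j by blast
    qed simp
    then show "runs (Seq (product_com ?R) (Assign ''right'' (var ''u'') (var ''x''))) ?s
      (18 * npow ?n 3 + 1) (\<lambda>s'. s' ''left'' = (s ''left'')(u := Num (left_val xs c)) \<and>
        s' ''right'' = (s ''right'')(u := Num (right_val xs c)))"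
    proof (rule runs_Seq_frame)
      fix s3 :: "'c state"
      assume ag3: "agree_off (writes (product_com ?R)) ?s s3" and x3: "s3 ''x'' 0 = Num (right_val xs c)"
      have "s3 ''u'' = s ''u''" "s3 ''right'' = s ''right''"
        using agree_offD[OF ag3] agree_offD[OF ag2] by simp_all
      moreover have "s3 ''left'' = (s ''left'')(u := Num (left_val xs c))"
        using agree_offD[OF ag3, of "''left''"] agree_offD[OF ag, of "''left''"] unfolding s2 by simp
      ultimately show "runs (Assign ''right'' (var ''u'') (var ''x'')) s3 1
        (\<lambda>s'. s' ''left'' = (s ''left'')(u := Num (left_val xs c)) \<and>
          s' ''right'' = (s ''right'')(u := Num (right_val xs c)))"
        using x3 u by (intro runs_Assign) simp_all
    qed
  qed
  then show ?thesis by (rule runs_mono) (use npow_ge_1[of ?n 3] in simp)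
qed

definition visit_com :: com where
  "visit_com = Seq (set_var ''p'' (Cell ''constant'' (var ''u'')))
     (Seq (set_var ''q'' (Cell ''constant'' (var ''u'')))
       (Seq inspect_com (Seq negation_com values_com)))"

lemma writes_visit_com [simp]: "writes visit_com = {''p'', ''q'', ''i'', ''k'', ''v'', ''reach'', ''j'',
    ''contradictory'', ''l'', ''x'', ''y'', ''z'', ''left'', ''right''}"
  by (auto simp: visit_com_def)

lemma runs_visit_com:
  fixes s :: "'c state"
  assumes ld: "loaded xs s" and u: "s ''u'' 0 = Num u" "u < 2 * length xs"
    and flag: "s ''contradictory'' 0 = Num (of_bool B)"
  shows "runs visit_com s (88 * npow (length xs) 3) (\<lambda>s'.
    s' ''contradictory'' 0 = Num (of_bool (B \<or> clash xs {node xs u} \<or> refuted xs (node xs u))) \<and>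
    s' ''left'' = (s ''left'')(u := Num (left_val xs (node xs u))) \<and>
    s' ''right'' = (s ''right'')(u := Num (right_val xs (node xs u))))" (is "runs _ _ _ ?Q")
proof -
  let ?n = "length xs"
  let ?c = "node xs u"
  let ?s = "upd (upd s ''p'' 0 (Con ?c)) ''q'' 0 (Con ?c)"
  have ag0: "agree_off {''p'', ''q''} s ?s"
    by (intro agree_off_upd agree_off_refl) simp_all
  have ld0: "loaded xs ?s" by (rule loaded_agree[OF ag0 _ ld]) simp
  have "runs inspect_com ?s (42 * npow ?n 3) (\<lambda>s'. marks xs (upset xs {?c}) s' \<and>
      s' ''contradictory'' 0 = Num (of_bool (B \<or> clash xs {?c})))"
    using runs_inspect_com[OF ld0, of ?c ?c B] flag by simp
  then have "runs (Seq inspect_com (Seq negation_com values_com)) ?s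
      (42 * npow ?n 3 + (6 * (?n + 1) + 38 * npow ?n 3)) ?Q"
  proof (rule runs_Seq_frame)
    fix s1 :: "'c state"
    assume ag1: "agree_off (writes inspect_com) ?s s1" and s1: "marks xs (upset xs {?c}) s1 \<and>
      s1 ''contradictory'' 0 = Num (of_bool (B \<or> clash xs {?c}))"
    have ld1: "loaded xs s1" by (rule loaded_agree[OF ag1 _ ld0]) simp
    have "s1 ''p'' 0 = Con ?c" using agree_offD[OF ag1] by simp
    from runs_negation_com[OF ld1 _ this] s1
    have "runs negation_com s1 (6 * (?n + 1))
      (\<lambda>s'. s' ''contradictory'' 0 = Num (of_bool ((B \<or> clash xs {?c}) \<or> refuted xs ?c)))" by blast
    then show "runs (Seq negation_com values_com) s1 (6 * (?n + 1) + 38 * npow ?n 3) ?Q"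
    proof (rule runs_Seq_frame)
      fix s2 :: "'c state"
      assume ag2: "agree_off (writes negation_com) s1 s2"
        and s2: "s2 ''contradictory'' 0 = Num (of_bool ((B \<or> clash xs {?c}) \<or> refuted xs ?c))"
      have ld2: "loaded xs s2" by (rule loaded_agree[OF ag2 _ ld1]) simp
      have mk2: "marks xs (upset xs {?c}) s2" by (rule marks_agree[OF ag2]) (use s1 in simp_all)
      have same: "s2 ''u'' = s ''u''" "s2 ''left'' = s ''left''" "s2 ''right'' = s ''right''"
        using agree_offD[OF ag2] agree_offD[OF ag1] by simp_all
      have "s2 ''u'' 0 = Num u" using same u by simp
      from runs_values_com[OF ld2 mk2 this]
      show "runs values_com s2 (38 * npow ?n 3) ?Q"
      proof (rule runs_conseq)
        fix s3 :: "'c state"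
        assume ag3: "agree_off (writes values_com) s2 s3"
          and "s3 ''left'' = (s2 ''left'')(u := Num (left_val xs ?c)) \<and>
            s3 ''right'' = (s2 ''right'')(u := Num (right_val xs ?c))"
        moreover have "s3 ''contradictory'' = s2 ''contradictory''"
          using agree_offD[OF ag3] by simp
        ultimately show "?Q s3" using s2 same by simp
      qed simp
    qed
  qed
  then have "runs visit_com s (1 + (1 + (42 * npow ?n 3 + (6 * (?n + 1) + 38 * npow ?n 3)))) ?Q"
    unfolding visit_com_def using ld u by (intro runs_Assign_Seq) (simp add: loaded_def)
  then show ?thesis by (rule runs_mono) (use npow_ge_n[of 3 ?n] in simp)
qed

definition visit_all_com :: com where
  "visit_all_com = FOR ''u'' (var ''rows'') visit_com"

lemma writes_visit_all_com [simp]: "writes visit_all_com = {''u'', ''p'', ''q'', ''i'', ''k'', ''v'', ''reach'', ''j'',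
    ''contradictory'', ''l'', ''x'', ''y'', ''z'', ''left'', ''right''}"
  by (auto simp: visit_all_com_def)

text \<open>The nodes exhaust the constants of the input, so a loop over the \<open>2 * n\<close>
  nodes, each at cubic cost, examines every constant and fills every row of the table.\<close>

lemma runs_visit_all_com:
  fixes s :: "'c state"
  assumes ld: "loaded xs s" and flag: "s ''contradictory'' 0 = Num 0"
  shows "runs visit_all_com s (180 * npow (length xs) 4) (\<lambda>s'.
    s' ''contradictory'' 0 = Num (of_bool (\<exists>c\<in>consts_of xs. clash xs {c} \<or> refuted xs c)) \<and>
    (\<forall>v<2 * length xs. s' ''left'' v = Num (left_val xs (node xs v)) \<and>
       s' ''right'' v = Num (right_val xs (node xs v))))"
proof -
  let ?n = "length xs"
  let ?bad = "\<lambda>c. clash xs {c} \<or> refuted xs c"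
  let ?J = "\<lambda>u (s' :: 'c state). s' ''contradictory'' 0 = Num (of_bool (\<exists>v<u. ?bad (node xs v))) \<and>
    (\<forall>v<u. s' ''left'' v = Num (left_val xs (node xs v)) \<and> s' ''right'' v = Num (right_val xs (node xs v)))"
  have "runs visit_all_com s (2 * ?n * (88 * npow ?n 3 + 2) + 2) (?J (2 * ?n))"
    unfolding visit_all_com_def
  proof (rule runs_FOR[where J = ?J])
    fix s' :: "'c state" assume ag: "agree_off (insert ''u'' (writes visit_com)) s s'"
    have "loaded xs s'" by (rule loaded_agree[OF ag _ ld]) simp
    then show "num (aval (var ''rows'') s') = 2 * ?n" by (simp add: loaded_def)
  next
    fix u and s' :: "'c state"
    assume u: "u < 2 * ?n" "s' ''u'' 0 = Num u" "?J u s'"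
      and ag: "agree_off (insert ''u'' (writes visit_com)) s s'"
    have "loaded xs s'" by (rule loaded_agree[OF ag _ ld]) simp
    note visit = runs_visit_com[OF this u(2,1) conjunct1[OF u(3)]]
    show "runs visit_com s' (88 * npow ?n 3) (\<lambda>s''. ?J (Suc u) (upd s'' ''u'' 0 (Num (Suc u))))"
    proof (rule runs_conseq[OF visit], goal_cases)
      case (1 s'')
      have "(\<exists>v<u. ?bad (node xs v)) \<or> ?bad (node xs u) \<longleftrightarrow> (\<exists>v<Suc u. ?bad (node xs v))"
        using less_Suc_eq by metis
      then show ?case using 1(2) conjunct2[OF u(3)] by (simp add: less_Suc_eq)
    qed simp
  qed (use flag in simp_all)
  then have "runs visit_all_com s (180 * npow ?n 4) (?J (2 * ?n))"
    by (rule runs_loop_time[where K = 88 and k = 3 and c = 2 and n = ?n]) simp_all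
  moreover have "(\<exists>v<2 * ?n. ?bad (node xs v)) \<longleftrightarrow> (\<exists>c\<in>consts_of xs. ?bad c)"
    unfolding node_image[symmetric] by auto
  ultimately show ?thesis by simp
qed

text \<open>Here \<open>u\<close> runs over sentences, not nodes. The command writes to neither
  \<open>left\<close> nor \<open>right\<close>, so the table filled before survives it.\<close>

definition inspect_pairs_com :: com where
  "inspect_pairs_com = FOR ''u'' (var ''n'') (guarded [Eq (Cell ''symbol'' (var ''u'')) (SymLit YI)]
     (Seq (set_var ''p'' (Cell ''constant'' (var ''u'')))
       (Seq (set_var ''q'' (Cell ''constant'' (Plus (var ''n'') (var ''u'')))) inspect_com)))"

lemma writes_inspect_pairs_com [simp]:
  "writes inspect_pairs_com = {''u'', ''p'', ''q'', ''i'', ''k'', ''v'', ''reach'', ''j'', ''contradictory''}"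
  by (auto simp: inspect_pairs_com_def)

lemma runs_inspect_pairs_com:
  fixes s :: "'c state"
  assumes ld: "loaded xs s" and flag: "s ''contradictory'' 0 = Num (of_bool B)"
  shows "runs inspect_pairs_com s (47 * npow (length xs) 4) (\<lambda>s'.
    s' ''contradictory'' 0 = Num (of_bool (B \<or> (\<exists>a b. (YI, a, b) \<in> set xs \<and> clash xs {a, b}))))"
  unfolding ex_entry_nth[of YI xs "\<lambda>a b. clash xs {a, b}"]
proof -
  let ?n = "length xs"
  let ?bad = "\<lambda>j. fst (xs ! j) = YI \<and> clash xs {fst (snd (xs ! j)), snd (snd (xs ! j))}"
  let ?J = "\<lambda>u (s' :: 'c state). s' ''contradictory'' 0 = Num (of_bool (B \<or> (\<exists>j<u. ?bad j)))"
  let ?bs = "[Eq (Cell ''symbol'' (var ''u'')) (SymLit YI)]"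
  let ?c = "Seq (set_var ''p'' (Cell ''constant'' (var ''u'')))
       (Seq (set_var ''q'' (Cell ''constant'' (Plus (var ''n'') (var ''u'')))) inspect_com)"
  have "runs inspect_pairs_com s (?n * (45 * npow ?n 3 + 2) + 2) (?J ?n)"
    unfolding inspect_pairs_com_def
  proof (rule runs_FOR[where J = ?J])
    fix s' :: "'c state" assume ag: "agree_off (insert ''u'' (writes (guarded ?bs ?c))) s s'"
    have "loaded xs s'" by (rule loaded_agree[OF ag _ ld]) simp
    then show "num (aval (var ''n'') s') = ?n" by (simp add: loaded_def)
  next
    fix u and s' :: "'c state"
    assume u: "u < ?n" "s' ''u'' 0 = Num u" "?J u s'"
      and ag: "agree_off (insert ''u'' (writes (guarded ?bs ?c))) s s'"
    have ld': "loaded xs s'" by (rule loaded_agree[OF ag _ ld]) simp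
    let ?a = "fst (snd (xs ! u))" and ?b = "snd (snd (xs ! u))"
    let ?s = "upd (upd s' ''p'' 0 (Con ?a)) ''q'' 0 (Con ?b)"
    have ag0: "agree_off {''p'', ''q''} s' ?s"
      by (intro agree_off_upd agree_off_refl) simp_all
    have ld0: "loaded xs ?s" by (rule loaded_agree[OF ag0 _ ld']) simp
    have test: "(\<forall>b\<in>set ?bs. holds b s') \<longleftrightarrow> fst (xs ! u) = YI"
      using ld' u by (simp add: loaded_def)
    have Suc: "(\<exists>j<Suc u. ?bad j) \<longleftrightarrow> (\<exists>j<u. ?bad j) \<or> ?bad u" using less_Suc_eq by metis
    have "runs (guarded ?bs ?c) s' (length ?bs + (1 + (1 + 42 * npow ?n 3))) (?J (Suc u))"
    proof (rule runs_guarded)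
      assume "\<forall>b\<in>set ?bs. holds b s'"
      then have YI: "fst (xs ! u) = YI" using test by blast
      have "runs inspect_com ?s (42 * npow ?n 3) (\<lambda>s'. marks xs (upset xs {?a, ?b}) s' \<and>
          s' ''contradictory'' 0 = Num (of_bool ((B \<or> (\<exists>j<u. ?bad j)) \<or> clash xs {?a, ?b})))"
        by (rule runs_inspect_com[OF ld0]) (use u(3) in simp_all)
      then have "runs inspect_com ?s (42 * npow ?n 3) (?J (Suc u))"
      proof (rule runs_conseq, goal_cases)
        case (1 s'')
        then show ?case unfolding Suc using YI by (simp add: disj_assoc)
      qed simp
      then show "runs ?c s' (1 + (1 + 42 * npow ?n 3)) (?J (Suc u))"
        using ld' u node_first[OF u(1)] node_second[OF u(1)]
        by (intro runs_Assign_Seq) (simp add: loaded_def)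
    next
      assume "\<not> (\<forall>b\<in>set ?bs. holds b s')"
      then have "fst (xs ! u) \<noteq> YI" using test by blast
      then show "?J (Suc u) s'" unfolding Suc using u(3) by simp
    qed
    then show "runs (guarded ?bs ?c) s' (45 * npow ?n 3)
        (\<lambda>s''. ?J (Suc u) (upd s'' ''u'' 0 (Num (Suc u))))"
      by (rule runs_conseq) (use npow_ge_1[of ?n 3] in simp_all)
  qed (use flag in simp_all)
  then show "runs inspect_pairs_com s (47 * npow ?n 4) (?J ?n)"
    by (rule runs_loop_time[where K = 45 and k = 3 and c = 1 and n = ?n]) simp_all
qed

text \<open>The value of \<open>rows\<close> is both the number of nodes and the length of the
  output table, which has one row per node.\<close>

definition load_com :: com where
  "load_com = Seq (FOR ''i'' (var ''n'')
      (Seq (Assign ''constant'' (var ''i'') (Cell ''first'' (var ''i'')))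
        (Assign ''constant'' (Plus (var ''n'') (var ''i'')) (Cell ''second'' (var ''i'')))))
    (set_var ''rows'' (Plus (var ''n'') (var ''n'')))"

lemma writes_load_com [simp]: "writes load_com = {''i'', ''constant'', ''rows''}"
  by (auto simp: load_com_def)

lemma runs_load_com: "runs load_com (input_state xs) (5 * npow (length xs) 1) (loaded xs)"
proof -
  let ?n = "length xs"
  let ?c = "Seq (Assign ''constant'' (var ''i'') (Cell ''first'' (var ''i'')))
        (Assign ''constant'' (Plus (var ''n'') (var ''i'')) (Cell ''second'' (var ''i'')))"
  let ?J = "\<lambda>k (s :: 'a state). \<forall>i<k. s ''constant'' i = Con (node xs i) \<and>
    s ''constant'' (?n + i) = Con (node xs (?n + i))"
  have "runs (FOR ''i'' (var ''n'') ?c) (input_state xs) (?n * (2 + 2) + 2) (?J ?n)"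
  proof (rule runs_FOR[where J = ?J])
    fix s :: "'a state" assume ag: "agree_off (insert ''i'' (writes ?c)) (input_state xs) s"
    then show "num (aval (var ''n'') s) = ?n"
      using agree_offD[OF ag, of "''n''"] by (simp add: input_state_def)
  next
    fix k and s :: "'a state"
    assume k: "k < ?n" "s ''i'' 0 = Num k" "?J k s"
      and ag: "agree_off (insert ''i'' (writes ?c)) (input_state xs) s"
    have input: "s ''n'' 0 = Num ?n" "s ''first'' k = Con (node xs k)" "s ''second'' k = Con (node xs (?n + k))"
      using agree_offD[OF ag, of "''n''"] agree_offD[OF ag, of "''first''"]
        agree_offD[OF ag, of "''second''"] k(1)
      by (simp_all add: input_state_def node_first node_second)
    have "runs ?c s (1 + 1) (\<lambda>s''. ?J (Suc k) (upd s'' ''i'' 0 (Num (Suc k))))"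
      using k input by (intro runs_Assign_Seq runs_Assign) (simp_all add: less_Suc_eq)
    then show "runs ?c s 2 (\<lambda>s''. ?J (Suc k) (upd s'' ''i'' 0 (Num (Suc k))))"
      by (rule runs_mono) simp
  qed simp_all
  then have "runs load_com (input_state xs) ((?n * (2 + 2) + 2) + 1) (loaded xs)"
    unfolding load_com_def
  proof (rule runs_Seq_frame)
    fix s :: "'a state"
    assume ag: "agree_off (writes (FOR ''i'' (var ''n'') ?c)) (input_state xs) s" and J: "?J ?n s"
    have input: "s ''n'' 0 = Num ?n" "\<And>i. i < ?n \<Longrightarrow> s ''symbol'' i = Sym (fst (xs ! i))"
      using agree_offD[OF ag, of "''n''"] agree_offD[OF ag, of "''symbol''"]
      by (simp_all add: input_state_def)
    have "s ''constant'' v = Con (node xs v)" if "v < 2 * ?n" for v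
    proof (cases "v < ?n")
      case True
      then show ?thesis using J by blast
    next
      case False
      then have "v - ?n < ?n" "v = ?n + (v - ?n)" using that by auto
      then show ?thesis using J by metis
    qed
    then show "runs (set_var ''rows'' (Plus (var ''n'') (var ''n''))) s 1 (loaded xs)"
      using input by (intro runs_Assign) (simp_all add: loaded_def)
  qed
  then show ?thesis by (rule runs_mono) simp
qed

section \<open>The whole program, its output and its running time\<close>

definition decide_com :: com where
  "decide_com = Seq load_com (Seq visit_all_com inspect_pairs_com)"

text \<open>The first constant of an O-sentence occurs in the input, so each O-sentence is tested
  when that constant is visited.\<close>

lemma conflicting_alt:
  "conflicting xs \<longleftrightarrow> (\<exists>c\<in>consts_of xs. clash xs {c} \<or> refuted xs c) \<or>
     (\<exists>a b. (YI, a, b) \<in> set xs \<and> clash xs {a, b})"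
proof -
  have "a \<in> consts_of xs" if "(YO, a, b) \<in> set xs" for a b
    using that unfolding consts_of_def by force
  then show ?thesis unfolding conflicting_def refuted_def by blast
qed

lemma runs_decide_com:
  "runs decide_com (input_state xs) (232 * npow (length xs) 4) (\<lambda>s. loaded xs s \<and>
    s ''contradictory'' 0 = Num (of_bool (conflicting xs)) \<and>
    (\<forall>v<2 * length xs. s ''left'' v = Num (left_val xs (node xs v)) \<and>
       s ''right'' v = Num (right_val xs (node xs v))))" (is "runs _ _ _ ?Q")
proof -
  let ?n = "length xs"
  let ?B = "\<exists>c\<in>consts_of xs. clash xs {c} \<or> refuted xs c"
  have "runs decide_com (input_state xs) (5 * npow ?n 1 + (180 * npow ?n 4 + 47 * npow ?n 4)) ?Q"
    unfolding decide_com_def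
  proof (rule runs_Seq_frame[OF runs_load_com])
    fix s1 :: "'a state"
    assume ag1: "agree_off (writes load_com) (input_state xs) s1" and ld1: "loaded xs s1"
    have "s1 ''contradictory'' 0 = Num 0"
      using agree_offD[OF ag1, of "''contradictory''"] by (simp add: input_state_def)
    from runs_visit_all_com[OF ld1 this]
    show "runs (Seq visit_all_com inspect_pairs_com) s1 (180 * npow ?n 4 + 47 * npow ?n 4) ?Q"
    proof (rule runs_Seq_frame)
      fix s2 :: "'a state"
      assume ag2: "agree_off (writes visit_all_com) s1 s2"
        and s2: "s2 ''contradictory'' 0 = Num (of_bool ?B) \<and>
          (\<forall>v<2 * ?n. s2 ''left'' v = Num (left_val xs (node xs v)) \<and>
            s2 ''right'' v = Num (right_val xs (node xs v)))"
      have ld2: "loaded xs s2" by (rule loaded_agree[OF ag2 _ ld1]) simp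
      from runs_inspect_pairs_com[OF ld2 conjunct1[OF s2]]
      show "runs inspect_pairs_com s2 (47 * npow ?n 4) ?Q"
      proof (rule runs_conseq, goal_cases)
        case (1 s3)
        have "loaded xs s3" by (rule loaded_agree[OF 1(1) _ ld2]) simp
        moreover have "s3 ''left'' = s2 ''left''" "s3 ''right'' = s2 ''right''"
          using agree_offD[OF 1(1)] by simp_all
        ultimately show ?case using 1(2) s2 unfolding conflicting_alt by simp
      qed simp
    qed
  qed
  then show ?thesis by (rule runs_mono) (use npow_mono[of 1 4 ?n] in simp)
qed

text \<open>A constant with several nodes produces several equal rows, which collapse because the
  table is compared as a set.\<close>

lemma outputs_canonical:
  assumes "loaded xs s"
    and "\<forall>v<2 * length xs. s ''left'' v = Num (left_val xs (node xs v)) \<and>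
       s ''right'' v = Num (right_val xs (node xs v))"
  shows "outputs_values s (consts_of xs) (canonical xs)"
proof -
  have row: "(s ''constant'' v, s ''left'' v, s ''right'' v) =
      (Con (node xs v), Num (fst (canonical xs (node xs v))), Num (snd (canonical xs (node xs v))))"
    if "v < 2 * length xs" for v
  proof -
    have "node xs v \<in> consts_of xs" unfolding node_image[symmetric] using that by simp
    then show ?thesis using assms that by (simp add: loaded_def canonical_def)
  qed
  have rows: "num (s ''rows'' 0) = 2 * length xs" using loaded_num(2)[OF assms(1)] by simp
  have "set (output_table s) = (\<lambda>v. (s ''constant'' v, s ''left'' v, s ''right'' v)) ` {..<2 * length xs}"
    unfolding output_table_def rows by (simp add: atLeast0LessThan)
  also have "\<dots> = (\<lambda>c. (Con c, Num (fst (canonical xs c)), Num (snd (canonical xs c)))) ` node xs ` {..<2 * length xs}"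
    unfolding image_image by (rule image_cong[OF refl], rule row) simp
  finally show ?thesis unfolding outputs_values_def node_image .
qed

text \<open>The leading term dominates the quartic bound for positive \<open>n\<close>. The constant
  term is for the empty input, where \<open>n ^ 8\<close> vanishes but the bound
  \<open>232 * (n + 1) ^ 4\<close> does not.\<close>

definition time_poly :: "nat poly" where
  "time_poly = monom 3712 8 + [:3712:]"

lemma degree_time_poly: "degree time_poly = 8"
  unfolding time_poly_def by (subst degree_add_eq_left) (simp_all add: degree_monom_eq)

text \<open>\<open>(n + 1)^4 \<le> 16 * n^8\<close> for positive \<open>n\<close>, and \<open>3712 = 232 * 16\<close>.\<close>

lemma time_le_poly: "232 * npow n 4 \<le> poly time_poly n"
proof (cases "n = 0")
  case True
  then show ?thesis by (simp add: npow_def time_poly_def poly_monom)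
next
  case False
  have "npow n 4 \<le> (2 * n) ^ 4" unfolding npow_def using False by (intro power_mono) auto
  also have "\<dots> = 16 * n ^ 4" by (simp add: power_mult_distrib)
  finally have "npow n 4 \<le> 16 * n ^ 4" .
  moreover have "n ^ 4 \<le> n ^ 8" using False by (intro power_increasing) auto
  ultimately have "232 * npow n 4 \<le> 3712 * n ^ 8" by linarith
  then show ?thesis by (simp add: time_poly_def poly_monom)
qed

theorem theorem3p2:
  fixes C :: "'c set"
  assumes three: "infinite C \<or> card C \<ge> 3"
  shows "\<exists>(prog :: com) (p :: nat poly) b0.
    degree p = 8 \<and> b0 \<in> leibniz_base \<and>
    (\<forall>\<Gamma> xs.
      \<Gamma> \<subseteq> BN C \<and> essentially_finite \<Gamma> \<and> \<not> plainly_contradictory C \<Gamma> \<and>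
      distinct xs \<and> set xs = \<Gamma> \<inter> BN (linked_consts \<Gamma>) \<longrightarrow>
      (\<exists>t s. exec prog (input_state xs) t s \<and>
        t \<le> poly p (card (\<Gamma> \<inter> BN (linked_consts \<Gamma>))) \<and>
        (if contradictory C \<Gamma> then verdict s = Num 1
         else verdict s = Num 0 \<and>
           (\<exists>\<mu>. leibniz_model C \<mu> \<Gamma> \<and> outputs_values s (linked_consts \<Gamma>) \<mu> \<and>
             (\<forall>c\<in>C - linked_consts \<Gamma>. \<mu> c = b0)))))"
proof (intro exI[of _ decide_com] exI[of _ time_poly] exI[of _ "(1, 1)"] conjI allI impI)
  show "degree time_poly = 8" by (rule degree_time_poly)
  show "(1, 1) \<in> leibniz_base" by (simp add: leibniz_base_def)
  fix \<Gamma> and xs :: "'c sentence list"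
  assume "\<Gamma> \<subseteq> BN C \<and> essentially_finite \<Gamma> \<and> \<not> plainly_contradictory C \<Gamma> \<and>
      distinct xs \<and> set xs = \<Gamma> \<inter> BN (linked_consts \<Gamma>)"
  then have G: "\<Gamma> \<subseteq> BN C" "\<not> plainly_contradictory C \<Gamma>" "distinct xs"
    and xs: "set xs = \<Gamma> \<inter> BN (linked_consts \<Gamma>)" by auto
  obtain t s where run: "exec decide_com (input_state xs) t s" "t \<le> 232 * npow (length xs) 4"
    and ld: "loaded xs s" and flag: "s ''contradictory'' 0 = Num (of_bool (conflicting xs))"
    and vals: "\<forall>v<2 * length xs. s ''left'' v = Num (left_val xs (node xs v)) \<and>
       s ''right'' v = Num (right_val xs (node xs v))"
    using runs_decide_com[of xs] unfolding runs_def by blast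
  \<comment> \<open>Distinctness makes the length of the list, which governs the time, equal to the
    number of sentences.\<close>
  have len: "card (\<Gamma> \<inter> BN (linked_consts \<Gamma>)) = length xs"
    unfolding xs[symmetric] using G(3) by (rule distinct_card)
  have "set xs \<subseteq> \<Gamma>" unfolding xs by simp
  note conflict = conflicting_imp_contradictory[OF this G(1)]
  note model = canonical_model[OF xs G(1,2)]
  \<comment> \<open>A conflict yields a derivable contradiction; without a conflict the canonical
    model exists, and soundness excludes a contradiction.\<close>
  have iff: "contradictory C \<Gamma> \<longleftrightarrow> conflicting xs"
    using conflict model leibniz_model_not_contradictory by blast
  have time: "t \<le> poly time_poly (card (\<Gamma> \<inter> BN (linked_consts \<Gamma>)))"
    unfolding len using run(2) time_le_poly[of "length xs"] by (rule order_trans)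
  have result: "if contradictory C \<Gamma> then verdict s = Num 1
    else verdict s = Num 0 \<and>
      (\<exists>\<mu>. leibniz_model C \<mu> \<Gamma> \<and> outputs_values s (linked_consts \<Gamma>) \<mu> \<and>
        (\<forall>c\<in>C - linked_consts \<Gamma>. \<mu> c = (1, 1)))"
  proof (cases "conflicting xs")
    case True
    then show ?thesis using iff flag by (simp add: verdict_def)
  next
    case False
    have "verdict s = Num 0" using False flag by (simp add: verdict_def)
    moreover have "outputs_values s (linked_consts \<Gamma>) (canonical xs)"
      using outputs_canonical[OF ld vals] unfolding consts_of_linked[OF xs] .
    moreover have "\<forall>c\<in>C - linked_consts \<Gamma>. canonical xs c = (1, 1)"
      unfolding consts_of_linked[OF xs, symmetric] by (simp add: canonical_def)
    ultimately show ?thesis unfolding iff if_not_P[OF False] using model[OF False] by blast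
  qed
  show "\<exists>t s. exec decide_com (input_state xs) t s \<and>
      t \<le> poly time_poly (card (\<Gamma> \<inter> BN (linked_consts \<Gamma>))) \<and>
      (if contradictory C \<Gamma> then verdict s = Num 1
       else verdict s = Num 0 \<and>
         (\<exists>\<mu>. leibniz_model C \<mu> \<Gamma> \<and> outputs_values s (linked_consts \<Gamma>) \<mu> \<and>
           (\<forall>c\<in>C - linked_consts \<Gamma>. \<mu> c = (1, 1))))"
    by (intro exI[of _ t] exI[of _ s] conjI run(1) time result)
qed

end
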